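(* Let $\rightsquigarrow$ be a 4-eternal relation, $G$ a finite group, $p$ a prime divisor of $|G|$, and $S$ a Sylow $p$-subgroup of $G$. Suppose that there exists a subgroup $D$ of $S$ with $1<|D|<|S|$ such that every subgroup of $S$ of order $|D|$ or $p|D|$ is abelian, every subgroup $H$ of $S$ of order $|D|$ satisfies $H\rightsquigarrow G$, and, if $p=2$, every cyclic subgroup $H$ of $S$ of order $4$ satisfies $H\rightsquigarrow G$. Then $\mathcal{F}_S(G)$ is supersolvable.
   Context: All groups are finite. $Z_{\mathfrak{U}}(G)$ denotes the supersolvable hypercenter of $G$: the largest normal subgroup $N$ of $G$ such that every chief factor of $G$ below $N$ is cyclic (of prime order). Let $\rightsquigarrow$ be a relation, defined for every finite group $G$, between subgroups $H\le G$ and $G$ (written $H\rightsquigarrow G$). It is called 4-eternal if for every finite group $G$ the following hold: (0) for all subgroups $H\le K\le G$, if $H\rightsquigarrow G$ then $H\rightsquigarrow K$; (4) for every prime divisor $p$ of $|G|$: if there exists a subgroup $D$ of $O_p(G)$ with $1<|D|<|O_p(G)|$ such that every subgroup $H$ of $O_p(G)$ of order $|D|$ satisfies $H\rightsquigarrow G$ and, in case $p=2$, every cyclic subgroup $H$ of $O_p(G)$ of order $4$ satisfies $H\rightsquigarrow G$, then $O_p(G)\le Z_{\mathfrak{U}}(G)$. $\mathcal{F}_S(G)$ is the (saturated) fusion system on $S\in\mathrm{Syl}_p(G)$ whose objects are the subgroups of $S$ and whose morphisms $P\to Q$ are the maps $x\mapsto x^g$ with $g\in G$, $P^g\le Q$.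 A saturated fusion system $\mathcal{F}$ on a $p$-group $S$ is supersolvable if there is a series $1=S_0\le S_1\le\cdots\le S_n=S$ of strongly $\mathcal{F}$-closed subgroups of $S$ with $S_{i+1}/S_i$ cyclic for $0\le i\le n-1$. (A subgroup $T\le S$ is strongly $\mathcal{F}$-closed if for every $P\le T$ and every $\phi\in\mathrm{Hom}_{\mathcal{F}}(P,S)$ one has $P^{\phi}\le T$.) *)

theory Defs
  imports "HOL-Algebra.Elementary_Groups" "HOL-Computational_Algebra.Primes"
begin

abbreviation subgp :: "('a, 'b) monoid_scheme \<Rightarrow> 'a set \<Rightarrow> ('a, 'b) monoid_scheme"
  where "subgp G H \<equiv> G\<lparr>carrier := H\<rparr>"

definition p_subgroup :: "nat \<Rightarrow> 'a set \<Rightarrow> 'a monoid \<Rightarrow> bool"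
  where "p_subgroup p P G \<longleftrightarrow> subgroup P G \<and> (\<exists>n. card P = p ^ n)"

definition sylow_subgroup :: "nat \<Rightarrow> 'a set \<Rightarrow> 'a monoid \<Rightarrow> bool"
  where "sylow_subgroup p P G \<longleftrightarrow> subgroup P G \<and> card P = p ^ multiplicity p (order G)"

definition p_core :: "nat \<Rightarrow> 'a monoid \<Rightarrow> 'a set"
  where "p_core p G = (GREATEST N. N \<lhd> G \<and> p_subgroup p N G)"

definition chief_factor :: "'a monoid \<Rightarrow> 'a set \<Rightarrow> 'a set \<Rightarrow> bool"
  where "chief_factor G H K \<longleftrightarrow> H \<lhd> G \<and> K \<lhd> G \<and> K \<subset> H \<and>
    \<not> (\<exists>L. L \<lhd> G \<and> K \<subset> L \<and> L \<subset> H)"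

(* A cyclic chief factor automatically has prime order. *)
definition supersolvable_hypercenter :: "'a monoid \<Rightarrow> 'a set"
  where "supersolvable_hypercenter G = (GREATEST N. N \<lhd> G \<and>
    (\<forall>H K. chief_factor G H K \<and> H \<subseteq> N \<longrightarrow> cyclic_group (subgp G H Mod K)))"

(* R H G stands for the relation between a subgroup H and its overgroup G; its values at
   arguments where H is not a subgroup of a finite group G are irrelevant.  The groups range over
   all finite groups with elements in 'a.  This costs no generality in statements about a given
   G and its subgroups: a relation satisfying these conditions on the subgroups of G satisfies
   them on all finite groups when it is taken to be empty elsewhere. *)
definition four_eternal :: "('a set \<Rightarrow> 'a monoid \<Rightarrow> bool) \<Rightarrow> bool"
  where "four_eternal R \<longleftrightarrow> (\<forall>G. group G \<and> finite (carrier G) \<longrightarrow>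
    (\<forall>H K. subgroup H G \<and> subgroup K G \<and> H \<subseteq> K \<and> R H G \<longrightarrow> R H (subgp G K)) \<and>
    (\<forall>p. prime p \<and> p dvd order G \<longrightarrow>
      (\<exists>D. subgroup D G \<and> D \<subseteq> p_core p G \<and> 1 < card D \<and> card D < card (p_core p G) \<and>
        (\<forall>H. subgroup H G \<and> H \<subseteq> p_core p G \<and> card H = card D \<longrightarrow> R H G) \<and>
        (p = 2 \<longrightarrow>
          (\<forall>H. subgroup H G \<and> H \<subseteq> p_core p G \<and> cyclic_group (subgp G H) \<and> card H = 4 \<longrightarrow> R H G)))
      \<longrightarrow> p_core p G \<subseteq> supersolvable_hypercenter G))"

(* A fusion system on a group S is given by its morphism sets: F P Q is the set of morphisms
   from P to Q, as functions that are undefined outside P. *)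
type_synonym 'a fusion = "'a set \<Rightarrow> 'a set \<Rightarrow> ('a \<Rightarrow> 'a) set"

definition group_fusion :: "'a monoid \<Rightarrow> 'a set \<Rightarrow> 'a fusion"
  where "group_fusion G S P Q = {restrict (\<lambda>x. inv\<^bsub>G\<^esub> g \<otimes>\<^bsub>G\<^esub> x \<otimes>\<^bsub>G\<^esub> g) P | g.
    g \<in> carrier G \<and> (\<lambda>x. inv\<^bsub>G\<^esub> g \<otimes>\<^bsub>G\<^esub> x \<otimes>\<^bsub>G\<^esub> g) ` P \<subseteq> Q \<and>
    subgroup P (subgp G S) \<and> subgroup Q (subgp G S)}"

definition strongly_closed :: "'a monoid \<Rightarrow> 'a fusion \<Rightarrow> 'a set \<Rightarrow> bool"
  where "strongly_closed S F T \<longleftrightarrow> subgroup T S \<and>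
    (\<forall>P \<phi>. subgroup P S \<and> P \<subseteq> T \<and> \<phi> \<in> F P (carrier S) \<longrightarrow> \<phi> ` P \<subseteq> T)"

(* Meant for saturated F, such as group_fusion G S for a Sylow subgroup S.  Strongly closed
   subgroups are then normal in S, because conjugations by elements of S are morphisms, so the
   quotients are groups. *)
definition supersolvable_fusion :: "'a monoid \<Rightarrow> 'a fusion \<Rightarrow> bool"
  where "supersolvable_fusion S F \<longleftrightarrow> (\<exists>(n::nat) T.
    T 0 = {\<one>\<^bsub>S\<^esub>} \<and> T n = carrier S \<and> (\<forall>i\<le>n. strongly_closed S F (T i)) \<and>
    (\<forall>i<n. T i \<subseteq> T (Suc i) \<and> cyclic_group (subgp S (T (Suc i)) Mod T i)))"

end

theory Submission
  imports Defs "HOL-Algebra.Group_Action" "HOL-Algebra.Sylow" "HOL-Algebra.Zassenhaus"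
    "HOL-Algebra.Multiplicative_Group"
begin

text \<open>
  Let P be a subgroup of S that contains its centralizer in S. Then P is larger than D: otherwise P
  would lie in an abelian subgroup of S of order p|D|, which centralizes P and is too large to lie in
  P. If moreover P is fully normalized and N is its normalizer in G, then
  P \<open>\<le>\<close> \<open>O\<^sub>p(N)\<close> \<open>\<le>\<close> S, so conditions (0) and (4) make every chief factor of N below P cyclic.
  The elements of N that act trivially on all these chief factors form a normal subgroup E, which
  contains the Sylow p-subgroup R of N. By coprime action the elements of E of order prime to p
  centralize P, so E = C R with C the centralizer of P, and the Frattini argument factorizes N as C
  times the normalizer of R in N. When P does not contain its centralizer in S, the Frattini argument
  in C yields a similar factorization. Hence every map of the fusion system extends, up to elements
  centralizing its domain, to larger subgroups of S, and downward induction on |P| shows that the normalizer of S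
  controls fusion in S. The theorem follows because S itself has a series of normal subgroups of that
  normalizer with cyclic factors.
\<close>

section \<open>Fixed points and conjugation\<close>

text \<open>Condition (4) sees only \<open>O_p\<close>, whereas fusion involves all subgroups of S.
  The bridge is a fully normalized P: then S meets N in a Sylow subgroup of N, and only this forces
  \<open>O_p(N)\<close> into S, where the hypotheses on subgroups of order |D| and 4 apply. D itself
  may lie outside \<open>O_p(N)\<close>, but any subgroup of the same order there serves, and |P| >
  |D| supplies the strict inequality that (4) demands. A second obstacle is that the hypercenter is
  given by \<open>GREATEST\<close>, which carries no information until a largest candidate is known
  to exist. Hence the argument in the style of Jordan and Hoelder that a product of two normal
  subgroups with cyclic chief factors has cyclic chief factors again. The induction is phrased
  through factorizations g = c n with c centralizing P and n normalizing S. Such factorizations can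
  be composed and inverted along the conjugates of P, and they restrict from larger subgroups to
  smaller ones, which is all that an argument of Alperin type needs.\<close>

lemma (in group_action) fixed_points_mod_prime:
  assumes "prime p" "finite E" "order G = p ^ n"
  shows "p dvd card {x \<in> E. \<exists>g\<in>carrier G. \<phi> g x \<noteq> x}"
proof -
  interpret G: group G using group_hom group_hom.axioms(1) by blast
  let ?M = "{x \<in> E. \<exists>g\<in>carrier G. \<phi> g x \<noteq> x}"
  let ?C = "{c \<in> orbits G E \<phi>. c \<subseteq> ?M}"
  have part: "partition E (orbits G E \<phi>)" by (rule orbit_partition)
  have fin: "finite (carrier G)" using assms(1,3) G.order_gt_0_iff_finite prime_gt_0_nat by auto
  have orb: "orbit G \<phi> x \<subseteq> ?M" if x: "x \<in> ?M" for x
  proof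
    fix y assume y: "y \<in> orbit G \<phi> x"
    have xE: "x \<in> E" using x by simp
    from y obtain a where a: "a \<in> carrier G" "y = \<phi> a x" by (auto simp: orbit_def)
    have yE: "y \<in> E" using a element_image xE by blast
    have "\<exists>g\<in>carrier G. \<phi> g y \<noteq> y"
    proof (rule ccontr)
      assume n: "\<not> ?thesis"
      have "x \<in> orbit G \<phi> y" using orbit_sym xE yE y by blast
      then have "x = y" using n by (auto simp: orbit_def)
      then show False using n x by auto
    qed
    then show "y \<in> ?M" using yE by simp
  qed
  have M: "?M = \<Union>?C"
  proof
    show "?M \<subseteq> \<Union>?C"
    proof
      fix x assume x: "x \<in> ?M"
      then have "x \<in> orbit G \<phi> x" "orbit G \<phi> x \<in> orbits G E \<phi>" using orbit_refl by (auto simp: orbits_def)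
      then show "x \<in> \<Union>?C" using orb[OF x] by blast
    qed
  qed auto
  \<comment> \<open>The orbit of a moved point has more than one element, and its length divides the
    order of the acting p-group.\<close>
  have dv: "p dvd card c" if c: "c \<in> ?C" for c
  proof -
    from c obtain x where x: "x \<in> E" "c = orbit G \<phi> x" by (auto simp: orbits_def)
    then have xc: "x \<in> c" using orbit_refl by blast
    with c obtain g where g: "g \<in> carrier G" "\<phi> g x \<noteq> x" by auto
    have gc: "\<phi> g x \<in> c" using g x by (auto simp: orbit_def)
    have finc: "finite c" using x fin by (simp add: orbit_def)
    have "card c \<noteq> 1"
    proof
      assume "card c = 1"
      then obtain z where "c = {z}" by (auto simp: card_Suc_eq)
      then show False using xc gc g by auto
    qed
    moreover have "card c dvd p ^ n"
      using orbit_stabilizer_theorem[OF x(1)] assms(3) x(2) by (metis dvd_triv_left)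
    ultimately show ?thesis using assms(1)
      by (metis divides_primepow_nat dvd_power_same le_0_eq not_gr0 power_0 dvd_power)
  qed
  have "pairwise disjnt ?C"
    unfolding pairwise_def disjnt_def
  proof (intro ballI impI)
    fix c d assume c: "c \<in> ?C" and d: "d \<in> ?C" and "c \<noteq> d"
    then show "c \<inter> d = {}" using partition.unique_class[OF part] by blast
  qed
  then have "p dvd card (\<Union>?C)"
    using dv assms(2) M by (intro dvd_partition) (auto simp: pairwise_def disjnt_def finite_subset[of ?M E])
  then show ?thesis using M by simp
qed

text \<open>The inverse turns right multiplication of right cosets into a left action, as
  \<open>group_action\<close> requires.\<close>

lemma (in group) coset_action:
  assumes "subgroup H G" "subgroup P G"
  shows "group_action (G\<lparr>carrier := H\<rparr>) (rcosets P) (\<lambda>h. \<lambda>c \<in> rcosets P. c #> inv h)"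
proof -
  let ?\<phi> = "\<lambda>h. \<lambda>c \<in> rcosets P. c #> inv h"
  have H: "h \<in> carrier G" if "h \<in> H" for h by (rule subgroup.mem_carrier[OF assms(1) that])
  have P: "P \<subseteq> carrier G" by (rule subgroup.subset[OF assms(2)])
  have cl: "c #> h \<in> rcosets P" if "c \<in> rcosets P" "h \<in> carrier G" for c h
    using that P by (auto simp: RCOSETS_def coset_mult_assoc)
  have ass: "(c #> g) #> h = c #> (g \<otimes> h)" if "c \<in> rcosets P" "h \<in> carrier G" "g \<in> carrier G" for c g h
    using that P by (auto simp: RCOSETS_def coset_mult_assoc m_assoc)
  have on: "c #> \<one> = c" if "c \<in> rcosets P" for c
    using that P by (auto simp: RCOSETS_def coset_mult_assoc)
  have bij: "?\<phi> h \<in> carrier (BijGroup (rcosets P))" if "h \<in> H" for h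
  proof -
    have "bij_betw (?\<phi> h) (rcosets P) (rcosets P)"
      using H[OF that]
      by (intro bij_betw_byWitness[where f' = "\<lambda>c. c #> h"]) (auto simp: cl ass on)
    then show ?thesis by (simp add: BijGroup_def Bij_def)
  qed
  have "?\<phi> (g \<otimes> h) = ?\<phi> g \<otimes>\<^bsub>BijGroup (rcosets P)\<^esub> ?\<phi> h" if g: "g \<in> H" and h: "h \<in> H" for g h
  proof -
    have "?\<phi> g \<otimes>\<^bsub>BijGroup (rcosets P)\<^esub> ?\<phi> h = compose (rcosets P) (?\<phi> g) (?\<phi> h)"
      using bij[OF g] bij[OF h] by (simp add: BijGroup_def)
    also have "\<dots> = ?\<phi> (g \<otimes> h)"
      using H[OF g] H[OF h] by (auto simp: compose_def fun_eq_iff cl ass inv_mult_group)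
    finally show ?thesis by simp
  qed
  then have "?\<phi> \<in> hom (G\<lparr>carrier := H\<rparr>) (BijGroup (rcosets P))"
    using bij by (auto simp: hom_def)
  then show ?thesis
    unfolding group_action_def group_hom_def group_hom_axioms_def
    using group_BijGroup subgroup.subgroup_is_group[OF assms(1) is_group] by blast
qed

text \<open>Right conjugation x^g, the map used in \<open>group_fusion\<close>. Conjugating by g and
  then by h is conjugating by g h, so products are read from left to right.\<close>

definition conjg :: "('a, 'b) monoid_scheme \<Rightarrow> 'a \<Rightarrow> 'a \<Rightarrow> 'a"
  where "conjg G g x = inv\<^bsub>G\<^esub> g \<otimes>\<^bsub>G\<^esub> x \<otimes>\<^bsub>G\<^esub> g"

definition Normalizer :: "('a, 'b) monoid_scheme \<Rightarrow> 'a set \<Rightarrow> 'a set"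
  where "Normalizer G H = {g \<in> carrier G. conjg G g ` H = H}"

definition Centralizer :: "('a, 'b) monoid_scheme \<Rightarrow> 'a set \<Rightarrow> 'a set"
  where "Centralizer G H = {g \<in> carrier G. \<forall>x\<in>H. conjg G g x = x}"

lemma conjg_subgp:
  assumes "group G" "subgroup H G" "g \<in> H"
  shows "conjg (subgp G H) g x = conjg G g x"
  using group.m_inv_consistent[OF assms] by (simp add: conjg_def)

section \<open>Calculus of conjugation; normalizers and centralizers\<close>

context group
begin

lemma mult_inv_cancel:
  "\<lbrakk>g \<in> carrier G; z \<in> carrier G\<rbrakk> \<Longrightarrow> g \<otimes> (inv g \<otimes> z) = z"
  "\<lbrakk>g \<in> carrier G; z \<in> carrier G\<rbrakk> \<Longrightarrow> inv g \<otimes> (g \<otimes> z) = z"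
  by (simp_all add: m_assoc[symmetric])

lemma conjg_closed [simp]: "\<lbrakk>g \<in> carrier G; x \<in> carrier G\<rbrakk> \<Longrightarrow> conjg G g x \<in> carrier G"
  by (simp add: conjg_def)

lemma conjg_mult:
  "\<lbrakk>g \<in> carrier G; x \<in> carrier G; y \<in> carrier G\<rbrakk> \<Longrightarrow> conjg G g (x \<otimes> y) = conjg G g x \<otimes> conjg G g y"
  by (simp add: conjg_def m_assoc mult_inv_cancel)

lemma conjg_hom: "g \<in> carrier G \<Longrightarrow> group_hom G G (conjg G g)"
  by (simp add: group_hom_def group_hom_axioms_def hom_def conjg_mult is_group)

lemma conjg_conjg:
  "\<lbrakk>g \<in> carrier G; h \<in> carrier G; x \<in> carrier G\<rbrakk> \<Longrightarrow> conjg G h (conjg G g x) = conjg G (g \<otimes> h) x"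
  by (simp add: conjg_def m_assoc inv_mult_group)

lemma conjg_one [simp]: "x \<in> carrier G \<Longrightarrow> conjg G \<one> x = x"
  by (simp add: conjg_def)

lemma conjg_inv_cancel [simp]:
  "\<lbrakk>g \<in> carrier G; x \<in> carrier G\<rbrakk> \<Longrightarrow> conjg G g (conjg G (inv g) x) = x"
  "\<lbrakk>g \<in> carrier G; x \<in> carrier G\<rbrakk> \<Longrightarrow> conjg G (inv g) (conjg G g x) = x"
  by (simp_all add: conjg_conjg)

lemma conjg_inj: "\<lbrakk>g \<in> carrier G; X \<subseteq> carrier G\<rbrakk> \<Longrightarrow> inj_on (conjg G g) X"
  by (rule inj_on_inverseI[where g = "conjg G (inv g)"]) auto

lemma card_conjg: "\<lbrakk>g \<in> carrier G; X \<subseteq> carrier G\<rbrakk> \<Longrightarrow> card (conjg G g ` X) = card X"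
  by (simp add: card_image conjg_inj)

lemma conjg_image_conjg:
  "\<lbrakk>g \<in> carrier G; h \<in> carrier G; X \<subseteq> carrier G\<rbrakk> \<Longrightarrow> conjg G h ` conjg G g ` X = conjg G (g \<otimes> h) ` X"
  by (auto simp: image_image conjg_conjg subset_iff intro!: image_cong)

lemma conjg_image_one: "X \<subseteq> carrier G \<Longrightarrow> conjg G \<one> ` X = X"
  by (force simp: image_def subset_iff)

lemma conjg_image_closed: "\<lbrakk>g \<in> carrier G; X \<subseteq> carrier G\<rbrakk> \<Longrightarrow> conjg G g ` X \<subseteq> carrier G"
  by auto

lemma conjg_image_inv:
  assumes "g \<in> carrier G" "X \<subseteq> carrier G"
  shows "conjg G (inv g) ` conjg G g ` X = X" "conjg G g ` conjg G (inv g) ` X = X"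
  using assms by (simp_all add: conjg_image_conjg conjg_image_one)

lemma subgroup_conjg: "\<lbrakk>g \<in> carrier G; subgroup H G\<rbrakk> \<Longrightarrow> subgroup (conjg G g ` H) G"
  using group_hom.subgroup_img_is_subgroup[OF conjg_hom] .

lemma conjg_image_subgroup:
  "\<lbrakk>subgroup H G; g \<in> H\<rbrakk> \<Longrightarrow> conjg G g ` H = H"
proof (intro subset_antisym subsetI)
  assume H: "subgroup H G" and g: "g \<in> H"
  have gc: "g \<in> carrier G" using subgroup.mem_carrier[OF H g] .
  fix x
  { assume "x \<in> conjg G g ` H"
    then show "x \<in> H" using H g by (auto simp: conjg_def subgroup.m_closed subgroup.m_inv_closed) }
  { assume x: "x \<in> H"
    then have "conjg G (inv g) x \<in> H" 
      using H g gc by (auto simp: conjg_def subgroup.m_closed subgroup.m_inv_closed)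
    moreover have "x = conjg G g (conjg G (inv g) x)" using gc subgroup.mem_carrier[OF H x] by simp
    ultimately show "x \<in> conjg G g ` H" by blast }
qed

lemma normal_conjg_iff: "N \<lhd> G \<longleftrightarrow> subgroup N G \<and> (\<forall>g\<in>carrier G. \<forall>x\<in>N. conjg G g x \<in> N)"
proof -
  have "(\<forall>g\<in>carrier G. \<forall>x\<in>N. g \<otimes> x \<otimes> inv g \<in> N) \<longleftrightarrow> (\<forall>g\<in>carrier G. \<forall>x\<in>N. conjg G g x \<in> N)"
    unfolding conjg_def by (metis inv_closed inv_inv)
  then show ?thesis by (simp add: normal_inv_iff)
qed

lemma conjg_image_eqI:
  assumes "finite H" "H \<subseteq> carrier G" "g \<in> carrier G" "conjg G g ` H \<subseteq> H"
  shows "conjg G g ` H = H"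
  using assms by (intro card_subset_eq) (auto simp: card_conjg)

lemma normal_conjg_image:
  assumes "N \<lhd> G" "g \<in> carrier G"
  shows "conjg G g ` N = N"
proof -
  have sub: "conjg G h ` N \<subseteq> N" if "h \<in> carrier G" for h
    using assms(1) that by (auto simp: normal_conjg_iff)
  have "conjg G g ` conjg G (inv g) ` N \<subseteq> conjg G g ` N" using sub assms(2) by (intro image_mono) simp
  then show ?thesis
    using sub assms normal_imp_subgroup[THEN subgroup.subset, OF assms(1)] by (simp add: conjg_image_inv subset_antisym)
qed

lemma subgroup_Normalizer:
  assumes "H \<subseteq> carrier G" shows "subgroup (Normalizer G H) G"
proof (rule subgroupI)
  show "Normalizer G H \<subseteq> carrier G" "Normalizer G H \<noteq> {}"
    using conjg_image_one[OF assms] by (auto simp: Normalizer_def)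
  fix a b assume a: "a \<in> Normalizer G H"
  then have "conjg G (inv a) ` H = conjg G (inv a) ` conjg G a ` H" "a \<in> carrier G" by (simp_all add: Normalizer_def)
  then show "inv a \<in> Normalizer G H" using conjg_image_inv(1)[OF _ assms] by (simp add: Normalizer_def)
  assume b: "b \<in> Normalizer G H"
  then show "a \<otimes> b \<in> Normalizer G H" using a
    using conjg_image_conjg[OF _ _ assms, of a b] by (simp add: Normalizer_def)
qed

lemma subgroup_Centralizer:
  assumes "H \<subseteq> carrier G" shows "subgroup (Centralizer G H) G"
proof (rule subgroupI)
  have H: "x \<in> carrier G" if "x \<in> H" for x using assms that by blast
  show "Centralizer G H \<subseteq> carrier G" "Centralizer G H \<noteq> {}"
    using H by (auto simp: Centralizer_def)
  fix a b assume a: "a \<in> Centralizer G H"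
  then have ac: "a \<in> carrier G" and ax: "conjg G a x = x" if "x \<in> H" for x
    using that by (auto simp: Centralizer_def)
  have "conjg G (inv a) x = x" if "x \<in> H" for x
    using conjg_inv_cancel(2)[OF ac H[OF that]] ax[OF that] that by simp
  then show "inv a \<in> Centralizer G H" using a by (simp add: Centralizer_def)
  assume b: "b \<in> Centralizer G H"
  then show "a \<otimes> b \<in> Centralizer G H" using a
    by (auto simp: Centralizer_def conjg_conjg[symmetric] H)
qed

lemma Centralizer_subset_Normalizer: "Centralizer G H \<subseteq> Normalizer G H"
  by (auto simp: Centralizer_def Normalizer_def)

lemma subset_Normalizer: "subgroup H G \<Longrightarrow> H \<subseteq> Normalizer G H"
  by (simp add: Normalizer_def conjg_image_subgroup subset_iff subgroup.mem_carrier)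

lemma normal_Normalizer: "subgroup H G \<Longrightarrow> H \<lhd> subgp G (Normalizer G H)"
proof -
  assume H: "subgroup H G"
  let ?N = "Normalizer G H"
  have N: "subgroup ?N G" by (rule subgroup_Normalizer[OF subgroup.subset[OF H]])
  have g: "group (subgp G ?N)" by (rule subgroup_imp_group[OF N])
  have "subgroup H (subgp G ?N)" by (rule subgroup_incl[OF H N subset_Normalizer[OF H]])
  then show ?thesis
    unfolding group.normal_conjg_iff[OF g] using conjg_subgp[OF is_group N] by (auto simp: Normalizer_def)
qed

lemma Centralizer_normal: 
  assumes "H \<subseteq> carrier G" 
  shows "Centralizer G H \<lhd> subgp G (Normalizer G H)"
proof -
  let ?N = "Normalizer G H"
  have N: "subgroup ?N G" by (rule subgroup_Normalizer[OF assms])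
  have g: "group (subgp G ?N)" by (rule subgroup_imp_group[OF N])
  have s: "subgroup (Centralizer G H) (subgp G ?N)" 
    by (rule subgroup_incl[OF subgroup_Centralizer[OF assms] N Centralizer_subset_Normalizer])
  have "conjg G g c \<in> Centralizer G H" if g: "g \<in> ?N" and c: "c \<in> Centralizer G H" for g c
  proof -
    have gc: "g \<in> carrier G" "c \<in> carrier G" using g c by (auto simp: Normalizer_def Centralizer_def)
    have "conjg G (conjg G g c) x = x" if "x \<in> H" for x
    proof -
      obtain y where y: "y \<in> H" "x = conjg G g y" using g \<open>x \<in> H\<close> by (auto simp: Normalizer_def)
      have yc: "y \<in> carrier G" using y assms by blast
      have "conjg G (conjg G g c) x = conjg G (g \<otimes> conjg G g c) y" using y gc yc by (simp add: conjg_conjg)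
      \<comment> \<open>Since g c^g = c g and c fixes y, the conjugate c^g fixes y^g = x.\<close>
      also have "g \<otimes> conjg G g c = c \<otimes> g" using gc by (simp add: conjg_def m_assoc[symmetric])
      also have "conjg G (c \<otimes> g) y = x" using y c gc yc by (simp add: conjg_conjg[symmetric] Centralizer_def)
      finally show ?thesis .
    qed
    then show ?thesis using gc by (simp add: Centralizer_def)
  qed
  then show ?thesis
    unfolding group.normal_conjg_iff[OF g] using s conjg_subgp[OF is_group N] by auto
qed

end

section \<open>Sylow theory\<close>

lemma (in group) subgroup_subgp_iff:
  assumes "subgroup N G"
  shows "subgroup R (subgp G N) \<longleftrightarrow> subgroup R G \<and> R \<subseteq> N"
proof
  assume R: "subgroup R (subgp G N)"
  show "subgroup R G \<and> R \<subseteq> N" using incl_subgroup[OF assms R] subgroup.subset[OF R] by simp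
next
  assume "subgroup R G \<and> R \<subseteq> N"
  then show "subgroup R (subgp G N)" using subgroup_incl[OF _ assms] by simp
qed

section \<open>Finite groups and Sylow's theorems by counting cosets\<close>

locale finite_group = group G for G :: "'a monoid" (structure) +
  assumes fin: "finite (carrier G)"
begin

lemma finite_group_subgp: "subgroup N G \<Longrightarrow> finite_group (subgp G N)"
  unfolding finite_group_def finite_group_axioms_def
  using subgroup_imp_group[of N] finite_subset[OF subgroup.subset fin] by auto

lemma finite_subgroup: "subgroup N G \<Longrightarrow> finite N"
  using finite_subset[OF subgroup.subset fin] .

lemma card_subgroup_pos: "subgroup N G \<Longrightarrow> card N > 0"
  using finite_subgroup[of N] subgroup.one_closed[of N G] card_gt_0_iff by blast

lemma card_subgroup_dvd: "subgroup H G \<Longrightarrow> card H dvd order G"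
  using lagrange[of H] by (metis dvd_triv_right)

lemma card_subgroup_dvd_subgroup:
  assumes "subgroup H G" "subgroup K G" "H \<subseteq> K"
  shows "card H dvd card K"
  using finite_group.card_subgroup_dvd[OF finite_group_subgp[OF assms(2)] subgroup_incl[OF assms]]
  by (simp add: order_def)

lemma order_pos: "order G > 0"
  using fin order_gt_0_iff_finite by blast

text \<open>Turns containment of a conjugate of H in P into a fixed point of the coset action.
  Conjugacy of Sylow subgroups and growth of normalizers are both counted this way.\<close>

lemma fixed_coset_iff:
  assumes "subgroup H G" "subgroup P G" "g \<in> carrier G"
  shows "(\<forall>h\<in>H. (P #> g) #> inv h = P #> g) \<longleftrightarrow> conjg G (inv g) ` H \<subseteq> P"
proof -
  have H: "h \<in> carrier G" if "h \<in> H" for h using subgroup.mem_carrier[OF assms(1) that] .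
  have P: "P \<subseteq> carrier G" using subgroup.subset[OF assms(2)] .
  have 1: "(P #> g) #> inv h = P #> g \<longleftrightarrow> conjg G (inv g) (inv h) \<in> P" if h: "h \<in> H" for h
  proof -
    have hc: "h \<in> carrier G" using H h by simp
    have "(P #> g) #> inv h = P #> (g \<otimes> inv h)" using assms(3) hc P by (simp add: coset_mult_assoc)
    also have "P #> (g \<otimes> inv h) = P #> g \<longleftrightarrow> g \<otimes> inv h \<otimes> inv g \<in> P"
    proof
      assume "P #> (g \<otimes> inv h) = P #> g"
      then have "P #> (g \<otimes> inv h \<otimes> inv g) = P" using coset_mult_inv2 assms(3) hc P by simp
      then show "g \<otimes> inv h \<otimes> inv g \<in> P" using coset_join1[OF _ _ assms(2)] assms(3) hc by simp
    next
      assume "g \<otimes> inv h \<otimes> inv g \<in> P"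
      then have "P #> (g \<otimes> inv h \<otimes> inv g) = P" using coset_join2[OF _ assms(2)] assms(3) hc by simp
      then show "P #> (g \<otimes> inv h) = P #> g" using coset_mult_inv1 assms(3) hc P by simp
    qed
    finally show ?thesis using assms(3) by (simp add: conjg_def)
  qed
  show ?thesis
  proof
    assume L: "\<forall>h\<in>H. (P #> g) #> inv h = P #> g"
    have "conjg G (inv g) h \<in> P" if "h \<in> H" for h
    proof -
      have "inv h \<in> H" using subgroup.m_inv_closed[OF assms(1) that] .
      moreover from this have "(P #> g) #> inv (inv h) = P #> g" using L by blast
      ultimately show ?thesis using 1[of "inv h"] H[OF that] by simp
    qed
    then show "conjg G (inv g) ` H \<subseteq> P" by blast
  next
    assume "conjg G (inv g) ` H \<subseteq> P"
    then show "\<forall>h\<in>H. (P #> g) #> inv h = P #> g"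
      using 1 subgroup.m_inv_closed[OF assms(1)] by blast
  qed
qed

lemma moved_cosets:
  assumes "prime p" "subgroup H G" "card H = p ^ n" "subgroup P G"
  shows "p dvd card {c \<in> rcosets P. \<exists>h\<in>H. c #> inv h \<noteq> c}"
proof -
  have f: "finite (rcosets P)"
    using finite_subset[OF rcosets_subset_PowG[OF assms(4)]] fin by simp
  have "p dvd card {x \<in> rcosets P. \<exists>g\<in>carrier (subgp G H). (\<lambda>c \<in> rcosets P. c #> inv g) x \<noteq> x}"
    using group_action.fixed_points_mod_prime[OF coset_action[OF assms(2,4)] assms(1) f, of n] assms(3)
    by (simp add: order_def)
  also have "{x \<in> rcosets P. \<exists>g\<in>carrier (subgp G H). (\<lambda>c \<in> rcosets P. c #> inv g) x \<noteq> x}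
     = {c \<in> rcosets P. \<exists>h\<in>H. c #> inv h \<noteq> c}" by auto
  finally show ?thesis .
qed

lemma index_not_dvd:
  assumes "prime p" "sylow_subgroup p P G"
  shows "\<not> p dvd card (rcosets P)"
proof
  assume "p dvd card (rcosets P)"
  then obtain k where "card (rcosets P) = p * k" by blast
  then have "order G = p ^ Suc (multiplicity p (order G)) * k"
    using lagrange[of P] assms(2) by (simp add: sylow_subgroup_def mult_ac)
  then have "p ^ Suc (multiplicity p (order G)) dvd order G" by (metis dvd_triv_left)
  then show False using assms(1) order_pos power_dvd_iff_le_multiplicity[of "order G" p]
    by (metis not_less_eq_eq le_refl less_not_refl not_prime_unit)
qed

text \<open>The number of cosets of P moved by H is a multiple of p, but the index of P is not, so H
  fixes some coset.\<close>

lemma sylow_contains_conj: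
  assumes "prime p" "sylow_subgroup p P G" "subgroup H G" "card H = p ^ n"
  shows "\<exists>g\<in>carrier G. conjg G g ` H \<subseteq> P"
proof -
  have P: "subgroup P G" using assms(2) by (simp add: sylow_subgroup_def)
  have "{c \<in> rcosets P. \<exists>h\<in>H. c #> inv h \<noteq> c} \<noteq> rcosets P"
    using moved_cosets[OF assms(1,3,4) P] index_not_dvd[OF assms(1,2)] by metis
  then obtain c where "c \<in> rcosets P" "\<forall>h\<in>H. c #> inv h = c" by blast
  then obtain g where "g \<in> carrier G" "\<forall>h\<in>H. (P #> g) #> inv h = P #> g"
    by (auto simp: RCOSETS_def)
  then show ?thesis using fixed_coset_iff[OF assms(3) P] by (intro bexI[of _ "inv g"]) auto
qed

lemma sylow_exists:
  assumes "prime p"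
  shows "\<exists>R. sylow_subgroup p R G"
proof -
  obtain m where "order G = p ^ multiplicity p (order G) * m"
    using multiplicity_dvd by blast
  then show ?thesis using sylow_thm[OF assms is_group _ fin] by (auto simp: sylow_subgroup_def)
qed

lemma card_p_subgroup_le:
  assumes "prime p" "subgroup H G" "card H = p ^ n"
  shows "n \<le> multiplicity p (order G)"
  using card_subgroup_dvd[OF assms(2)] order_pos assms(1,3) power_dvd_iff_le_multiplicity[of "order G" p n]
  by (metis less_not_refl not_prime_unit)

lemma sylow_conj:
  assumes "sylow_subgroup p R G" "g \<in> carrier G"
  shows "sylow_subgroup p (conjg G g ` R) G"
  using assms subgroup_conjg[OF assms(2), of R] card_conjg[OF assms(2), of R]
  by (simp add: sylow_subgroup_def subgroup.subset)

lemma normal_p_subgroup_in_sylow: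
  assumes "prime p" "sylow_subgroup p R G" "M \<lhd> G" "card M = p ^ n"
  shows "M \<subseteq> R"
proof -
  obtain g where "g \<in> carrier G" "conjg G g ` M \<subseteq> R"
    using sylow_contains_conj[OF assms(1,2) normal_imp_subgroup[OF assms(3)] assms(4)] by blast
  then show ?thesis using normal_conjg_image[OF assms(3)] by simp
qed

text \<open>A Sylow subgroup of C can be conjugated into R and stays in C by normality, so the
  intersection is large enough; being a p-subgroup of C it cannot be larger.\<close>

lemma sylow_Int_normal:
  assumes "prime p" "sylow_subgroup p R G" "C \<lhd> G"
  shows "sylow_subgroup p (R \<inter> C) (subgp G C)"
proof -
  have C: "subgroup C G" using normal_imp_subgroup[OF assms(3)] .
  have R: "subgroup R G" using assms(2) by (simp add: sylow_subgroup_def)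
  have RC: "subgroup (R \<inter> C) G" using subgroups_Inter_pair[OF R C] .
  obtain Z where "sylow_subgroup p Z (subgp G C)"
    using finite_group.sylow_exists[OF finite_group_subgp[OF C] assms(1)] by blast
  then have Z: "subgroup Z G" "Z \<subseteq> C" "card Z = p ^ multiplicity p (card C)"
    by (simp_all add: sylow_subgroup_def subgroup_subgp_iff[OF C] order_def)
  obtain g where g: "g \<in> carrier G" "conjg G g ` Z \<subseteq> R"
    using sylow_contains_conj[OF assms(1,2) Z(1,3)] by blast
  have "conjg G g ` Z \<subseteq> R \<inter> C"
    using g Z(2) assms(3) by (auto simp: normal_conjg_iff)
  then have 1: "card Z \<le> card (R \<inter> C)"
    using card_conjg[OF g(1) subgroup.subset[OF Z(1)]] card_mono[OF finite_subgroup[OF RC]] by metis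
  have "card (R \<inter> C) dvd p ^ multiplicity p (order G)"
    using card_subgroup_dvd_subgroup[OF RC R] assms(2) by (simp add: sylow_subgroup_def)
  then obtain k where k: "card (R \<inter> C) = p ^ k" using assms(1) divides_primepow_nat by blast
  have "k \<le> multiplicity p (order (subgp G C))"
    using finite_group.card_p_subgroup_le[OF finite_group_subgp[OF C] assms(1) _ k] RC
    by (simp add: subgroup_subgp_iff[OF C])
  then have "card (R \<inter> C) \<le> card Z"
    using k Z(3) prime_gt_0_nat[OF assms(1)] by (auto simp: order_def intro!: power_increasing)
  then show ?thesis using 1 Z(3) RC by (simp add: sylow_subgroup_def subgroup_subgp_iff[OF C] order_def)
qed

text \<open>The conjugate of R by x^-1 lies in E, so some e in E carries it back to R, and x^-1 e
  normalizes R. The factor from E stands on the left, where it acts first.\<close>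

lemma frattini:
  assumes "prime p" "E \<lhd> G" "sylow_subgroup p R (subgp G E)" "x \<in> carrier G"
  shows "\<exists>e\<in>E. \<exists>y\<in>Normalizer G R. x = e \<otimes> y"
proof -
  have E: "subgroup E G" using normal_imp_subgroup[OF assms(2)] .
  interpret E: finite_group "subgp G E" using finite_group_subgp[OF E] .
  have R: "subgroup R G" "R \<subseteq> E" "card R = p ^ multiplicity p (card E)"
    using assms(3) by (simp_all add: sylow_subgroup_def subgroup_subgp_iff[OF E] order_def)
  have Rc: "R \<subseteq> carrier G" using subgroup.subset[OF R(1)] .
  let ?Q = "conjg G (inv x) ` R"
  have "subgroup ?Q (subgp G E)"
    using R(2) assms(2,4) subgroup_conjg[OF _ R(1)] by (auto simp: subgroup_subgp_iff[OF E] normal_conjg_iff)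
  moreover have "card ?Q = p ^ multiplicity p (card E)" using card_conjg[OF _ Rc] assms(4) R(3) by simp
  ultimately obtain e where e: "e \<in> E" "conjg (subgp G E) e ` ?Q \<subseteq> R"
    using E.sylow_contains_conj[OF assms(1,3), of ?Q "multiplicity p (card E)"] by auto
  have ec: "e \<in> carrier G" using subgroup.mem_carrier[OF E e(1)] .
  have "conjg G (inv x \<otimes> e) ` R \<subseteq> R"
    using e(2) conjg_subgp[OF is_group E e(1)] conjg_image_conjg[OF _ ec Rc, of "inv x"] assms(4) by simp
  then have "conjg G (inv x \<otimes> e) ` R = R"
    using conjg_image_eqI[OF finite_subgroup[OF R(1)] Rc] ec assms(4) by simp
  then have "inv x \<otimes> e \<in> Normalizer G R" using ec assms(4) by (simp add: Normalizer_def)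
  then have "inv (inv x \<otimes> e) \<in> Normalizer G R" using subgroup.m_inv_closed[OF subgroup_Normalizer[OF Rc]] by blast
  moreover have "x = e \<otimes> inv (inv x \<otimes> e)" using ec assms(4) by (simp add: inv_mult_group mult_inv_cancel)
  ultimately show ?thesis using e(1) by blast
qed

section \<open>Normalizers and overgroups in finite p-groups\<close>

lemma p_group_index_dvd:
  assumes "prime p" "order G = p ^ n" "subgroup P G" "P \<noteq> carrier G"
  shows "p dvd card (rcosets P)"
proof -
  have "card (rcosets P) dvd p ^ n" using lagrange[OF assms(3)] assms(2) by (metis dvd_triv_left)
  then obtain k where k: "card (rcosets P) = p ^ k" using assms(1) divides_primepow_nat by blast
  have "card P \<noteq> card (carrier G)"
    using card_seteq[OF fin subgroup.subset[OF assms(3)]] assms(4) by auto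
  then have "card (rcosets P) \<noteq> 1" using lagrange[OF assms(3)] by (auto simp: order_def)
  then have "k \<noteq> 0" using k by (cases k) auto
  then show ?thesis using k by simp
qed

text \<open>P acts on its own cosets. The number of fixed cosets is divisible by p and P is one of
  them, so there is another, P g; then g^-1 normalizes P without lying in P.\<close>

lemma p_group_normalizer_grows:
  assumes "prime p" "order G = p ^ n" "subgroup P G" "P \<noteq> carrier G"
  shows "P \<subset> Normalizer G P"
proof -
  have Pc: "P \<subseteq> carrier G" using subgroup.subset[OF assms(3)] .
  have finr: "finite (rcosets P)"
    using finite_subset[OF rcosets_subset_PowG[OF assms(3)]] fin by simp
  obtain k where k: "card P = p ^ k"
    using card_subgroup_dvd[OF assms(3)] assms(1,2) divides_primepow_nat by auto
  let ?M = "{c \<in> rcosets P. \<exists>h\<in>P. c #> inv h \<noteq> c}"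
  have "card (rcosets P - ?M) = card (rcosets P) - card ?M" using finr by (intro card_Diff_subset) auto
  then have dv: "p dvd card (rcosets P - ?M)"
    using moved_cosets[OF assms(1,3) k assms(3)] p_group_index_dvd[OF assms] by simp
  have Pr: "P = P #> \<one>" using Pc by simp
  have "P #> \<one> \<in> rcosets P" using rcosetsI[OF Pc one_closed] .
  moreover have "\<forall>h\<in>P. (P #> \<one>) #> inv h = P #> \<one>"
    using fixed_coset_iff[OF assms(3,3) one_closed] conjg_image_one[OF Pc] by simp
  ultimately have in1: "P \<in> rcosets P - ?M" using Pr by simp
  have "rcosets P - ?M \<noteq> {P}"
  proof
    assume "rcosets P - ?M = {P}"
    then have "p dvd 1" using dv by simp
    then show False using assms(1) by simp
  qed
  then obtain c where c: "c \<in> rcosets P" "c \<notin> ?M" "c \<noteq> P" using in1 by blast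
  then obtain g where g: "g \<in> carrier G" "c = P #> g" by (auto simp: RCOSETS_def)
  have "conjg G (inv g) ` P \<subseteq> P"
    using fixed_coset_iff[OF assms(3,3) g(1)] c(1,2) g(2) by blast
  then have n: "inv g \<in> Normalizer G P"
    using conjg_image_eqI[OF finite_subgroup[OF assms(3)] Pc] g(1) by (simp add: Normalizer_def)
  have "inv g \<notin> P"
  proof
    assume "inv g \<in> P"
    then have "g \<in> P" using subgroup.m_inv_closed[OF assms(3)] g(1) by fastforce
    then show False using c(3) g coset_join2[OF g(1) assms(3)] by simp
  qed
  then show ?thesis using n subset_Normalizer[OF assms(3)] by blast
qed

lemma card_FactGroup_subgroup:
  assumes "P \<lhd> G" "subgroup A (G Mod P)"
  shows "card (\<Union>A) = card A * card P"
proof -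
  have P: "subgroup P G" using normal_imp_subgroup[OF assms(1)] .
  have A: "A \<subseteq> rcosets P" using subgroup.subset[OF assms(2)] by (simp add: FactGroup_def)
  have fA: "finite A"
    using finite_subset[OF A] finite_subset[OF rcosets_subset_PowG[OF P]] fin by simp
  have "card (\<Union>A) = (\<Sum>c\<in>A. card c)"
    using A rcos_disjoint[OF P] cosets_finite[OF _ subgroup.subset[OF P] fin]
    by (intro card_Union_disjoint) (auto simp: pairwise_def subset_iff)
  also have "\<dots> = (\<Sum>c\<in>A. card P)" using A card_rcosets_equal[OF _ subgroup.subset[OF P]] by (intro sum.cong) auto
  finally show ?thesis by simp
qed

lemma p_group_subgroup_grows:
  assumes "prime p" "order G = p ^ n" "subgroup P G" "P \<noteq> carrier G"
  shows "\<exists>T. subgroup T G \<and> P \<subseteq> T \<and> card T = p * card P"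
proof -
  let ?N = "Normalizer G P"
  have N: "subgroup ?N G" using subgroup_Normalizer[OF subgroup.subset[OF assms(3)]] .
  interpret N: finite_group "subgp G ?N" using finite_group_subgp[OF N] .
  have nP: "P \<lhd> subgp G ?N" using normal_Normalizer[OF assms(3)] .
  have PN: "subgroup P (subgp G ?N)" using normal_imp_subgroup[OF nP] .
  have gr: "P \<noteq> ?N" using p_group_normalizer_grows[OF assms] by blast
  obtain k where k: "order (subgp G ?N) = p ^ k"
    using card_subgroup_dvd[OF N] assms(1,2) divides_primepow_nat by (auto simp: order_def)
  let ?Q = "subgp G ?N Mod P"
  have Q: "group ?Q" using normal.factorgroup_is_group[OF nP] .
  have oQ: "order ?Q = card (rcosets\<^bsub>subgp G ?N\<^esub> P)" by (simp add: order_def FactGroup_def)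
  have "p dvd order ?Q" using N.p_group_index_dvd[OF assms(1) k PN] gr oQ by simp
  \<comment> \<open>With exponent 1, \<open>sylow_thm\<close> becomes Cauchy's theorem and gives a
    subgroup of order p in the quotient.\<close>
  then obtain m where m: "order ?Q = p ^ 1 * m" by auto
  have fQ: "finite (carrier ?Q)"
    using N.fin finite_subset[OF N.rcosets_subset_PowG[OF PN]] by (simp add: FactGroup_def)
  obtain A where A: "subgroup A ?Q" "card A = p" using sylow_thm[OF assms(1) Q m fQ] by auto
  have U: "subgroup (\<Union>A) (subgp G ?N)" using normal.factgroup_subgroup_union_subgroup[OF nP A(1)] .
  have "P \<in> A" using subgroup.one_closed[OF A(1)] by simp
  then have "P \<subseteq> \<Union>A" by blast
  moreover have "card (\<Union>A) = p * card P" using N.card_FactGroup_subgroup[OF nP A(1)] A(2) by simp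
  ultimately show ?thesis using U by (auto simp: subgroup_subgp_iff[OF N])
qed

text \<open>Enlarges P by a factor p at a time. Starting from the trivial subgroup it provides
  subgroups of order |D|; starting from a small P it provides the abelian overgroup of order
  p|D|.\<close>

lemma p_group_overgroup:
  assumes "prime p" "order G = p ^ n" "subgroup P G" "card P \<le> p ^ k" "k \<le> n"
  shows "\<exists>T. subgroup T G \<and> P \<subseteq> T \<and> card T = p ^ k"
  using assms(3,4)
proof (induction "order G - card P" arbitrary: P rule: less_induct)
  case less
  obtain j where j: "card P = p ^ j"
    using card_subgroup_dvd[OF less.prems(1)] assms(1,2) divides_primepow_nat by auto
  show ?case
  proof (cases "j = k")
    case True
    then show ?thesis using j less.prems by blast
  next
    case False
    have jk: "j < k"
      using False less.prems(2) j prime_gt_1_nat[OF assms(1)] by (simp add: le_less)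
    then have "p ^ j < p ^ n" using assms(5) prime_gt_1_nat[OF assms(1)] by simp
    then have lt: "card P < order G" using j assms(2) by simp
    then have "P \<noteq> carrier G" by (auto simp: order_def)
    then obtain T where T: "subgroup T G" "P \<subseteq> T" "card T = p * card P"
      using p_group_subgroup_grows[OF assms(1,2) less.prems(1)] by blast
    have "card T = p ^ Suc j" using T(3) j by simp
    moreover have "p ^ Suc j \<le> p ^ k"
      using jk prime_gt_0_nat[OF assms(1)] by (intro power_increasing) auto
    moreover have "card P < card T" using T(3) card_subgroup_pos[OF less.prems(1)] prime_gt_1_nat[OF assms(1)] by simp
    moreover from this have "order G - card T < order G - card P" using lt by simp
    ultimately obtain U where "subgroup U G" "T \<subseteq> U" "card U = p ^ k"
      using less.hyps[of T] T(1) by auto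
    then show ?thesis using T(2) by blast
  qed
qed

section \<open>The p-core and the supersolvable hypercenter\<close>

text \<open>For inclusion, which is only a partial order, \<open>GREATEST\<close> is determined once
  a candidate contains all others; exhibiting one is the task for both the p-core and the
  hypercenter.\<close>

lemma Greatest_subset:
  fixes Q :: "'a set \<Rightarrow> bool"
  assumes "Q M" "\<And>N. Q N \<Longrightarrow> N \<subseteq> M"
  shows "(GREATEST N. Q N) = M"
  using assms by (intro Greatest_equality) auto

text \<open>The witness is the intersection of all conjugates of one Sylow subgroup R: a normal
  p-subgroup lies in every Sylow subgroup.\<close>

lemma p_core_eq:
  assumes "prime p"
  shows "p_core p G \<lhd> G \<and> p_subgroup p (p_core p G) G \<and>
    (\<forall>N. N \<lhd> G \<and> p_subgroup p N G \<longrightarrow> N \<subseteq> p_core p G)"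
proof -
  obtain R where R: "sylow_subgroup p R G" using sylow_exists[OF assms] by blast
  then have Rs: "subgroup R G" by (simp add: sylow_subgroup_def)
  have Rc: "R \<subseteq> carrier G" using subgroup.subset[OF Rs] .
  let ?M = "\<Inter>g\<in>carrier G. conjg G g ` R"
  have Ms: "subgroup ?M G"
    using subgroups_Inter[of "(\<lambda>g. conjg G g ` R) ` carrier G"] subgroup_conjg[OF _ Rs] one_closed by blast
  have MR: "?M \<subseteq> R" using conjg_image_one[OF Rc] one_closed by blast
  have "conjg G h x \<in> ?M" if h: "h \<in> carrier G" and x: "x \<in> ?M" for h x
  proof
    fix g assume g: "g \<in> carrier G"
    \<comment> \<open>To place x^h in R^g, use that x lies in the conjugate of R by g h^-1.\<close>
    have "x \<in> conjg G (g \<otimes> inv h) ` R" using x g h by (metis INT_E inv_closed m_closed)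
    then have "conjg G h x \<in> conjg G h ` conjg G (g \<otimes> inv h) ` R" by blast
    also have "\<dots> = conjg G g ` R" using g h conjg_image_conjg[of "g \<otimes> inv h" h R] Rc by (simp add: m_assoc)
    finally show "conjg G h x \<in> conjg G g ` R" .
  qed
  then have Mn: "?M \<lhd> G" using Ms by (simp only: normal_conjg_iff) blast
  have "card ?M dvd p ^ multiplicity p (order G)"
    using card_subgroup_dvd_subgroup[OF Ms Rs MR] R by (simp add: sylow_subgroup_def)
  then have Mp: "p_subgroup p ?M G" using Ms assms divides_primepow_nat unfolding p_subgroup_def by blast
  have max: "N \<subseteq> ?M" if N: "N \<lhd> G" "p_subgroup p N G" for N
  proof -
    obtain n where n: "card N = p ^ n" using N(2) by (auto simp: p_subgroup_def)
    have "N \<subseteq> conjg G g ` R" if "g \<in> carrier G" for g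
      using normal_p_subgroup_in_sylow[OF assms sylow_conj[OF R that] N(1) n] .
    then show ?thesis by blast
  qed
  have "p_core p G = ?M" unfolding p_core_def using Mn Mp max by (intro Greatest_subset) auto
  then show ?thesis using Mn Mp max by simp
qed

lemma p_core_normal: "prime p \<Longrightarrow> p_core p G \<lhd> G"
  using p_core_eq by blast

lemma card_p_core: "prime p \<Longrightarrow> \<exists>n. card (p_core p G) = p ^ n"
  using p_core_eq[of p] by (simp add: p_subgroup_def)

lemma subset_p_core: "\<lbrakk>prime p; N \<lhd> G; card N = p ^ n\<rbrakk> \<Longrightarrow> N \<subseteq> p_core p G"
  using p_core_eq[of p] normal_imp_subgroup[of N G] by (auto simp: p_subgroup_def)

end

section \<open>Cyclic quotients by elements, and products of normal subgroups modulo a third\<close>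

lemma (in group) cyclic_factor_iff:
  assumes "K \<lhd> G" "subgroup H G" "K \<subseteq> H"
  shows "cyclic_group (subgp G H Mod K) \<longleftrightarrow> (\<exists>x\<in>H. \<forall>y\<in>H. \<exists>k::int. y \<in> K #> x [^] k)"
proof -
  have n: "K \<lhd> subgp G H" using normal_restrict_supergroup[OF assms(2,1,3)] .
  interpret Q: group "subgp G H Mod K" using normal.factorgroup_is_group[OF n] .
  interpret H: group "subgp G H" using subgroup_imp_group[OF assms(2)] .
  have K: "subgroup K G" using normal_imp_subgroup[OF assms(1)] .
  have Hc: "x \<in> carrier G" if "x \<in> H" for x using subgroup.mem_carrier[OF assms(2) that] .
  have car: "carrier (subgp G H Mod K) = (\<lambda>x. K #> x) ` H" by (simp add: carrier_FactGroup)
  have pw: "(K #> x) [^]\<^bsub>subgp G H Mod K\<^esub> k = K #> x [^] k" if "x \<in> H" for x and k :: int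
    using normal.FactGroup_int_pow[OF n, of x k] that int_pow_consistent[OF assms(2) that, of k] by simp
  have pH: "x [^] k \<in> H" if "x \<in> H" for x and k :: int
    using H.int_pow_closed[of x k] int_pow_consistent[OF assms(2) that, of k] that by simp
  have mem: "y \<in> K #> z \<longleftrightarrow> K #> y = K #> z" if "y \<in> H" "z \<in> H" for y z
    using repr_independence[OF _ _ K, of y z] rcos_self[OF _ K, of y] Hc that by auto
  have "cyclic_group (subgp G H Mod K) \<longleftrightarrow>
      (\<exists>x\<in>H. (\<lambda>y. K #> y) ` H = range (\<lambda>k::int. K #> x [^] k))"
    unfolding Q.cyclic_group car using pw by simp
  also have "\<dots> \<longleftrightarrow> (\<exists>x\<in>H. (\<lambda>y. K #> y) ` H \<subseteq> range (\<lambda>k::int. K #> x [^] k))"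
  proof (intro bex_cong refl)
    fix x assume "x \<in> H"
    then have "range (\<lambda>k::int. K #> x [^] k) \<subseteq> (\<lambda>y. K #> y) ` H" using pH by blast
    then show "(\<lambda>y. K #> y) ` H = range (\<lambda>k::int. K #> x [^] k) \<longleftrightarrow>
      (\<lambda>y. K #> y) ` H \<subseteq> range (\<lambda>k::int. K #> x [^] k)" by (simp add: set_eq_subset)
  qed
  also have "\<dots> \<longleftrightarrow> (\<exists>x\<in>H. \<forall>y\<in>H. \<exists>k::int. y \<in> K #> x [^] k)"
    unfolding image_subset_iff image_iff using mem[OF _ pH] by (intro bex_cong refl ball_cong) simp
  finally show ?thesis .
qed

context group
begin

lemma r_coset_eq_iff:
  assumes "subgroup X G" "a \<in> carrier G" "b \<in> carrier G"
  shows "X #> a = X #> b \<longleftrightarrow> a \<otimes> inv b \<in> X"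
  using repr_independence[OF _ assms(3,1), of a] rcos_self[OF assms(2,1)]
    subgroup.rcos_module[OF assms(1) is_group assms(3,2)] by auto

text \<open>Describes the product X J by its image modulo X, so that normal subgroups can be
  compared through equalities of cosets of X.\<close>

lemma mem_set_mult_iff:
  assumes "subgroup X G" "J \<subseteq> carrier G" "y \<in> carrier G"
  shows "y \<in> X <#> J \<longleftrightarrow> (\<exists>j\<in>J. X #> y = X #> j)"
proof
  assume "y \<in> X <#> J"
  then obtain x j where xj: "x \<in> X" "j \<in> J" "y = x \<otimes> j" by (auto simp: set_mult_def)
  then have "X #> y = X #> j"
    using r_coset_eq_iff[OF assms(1,3), of j] subgroup.mem_carrier[OF assms(1)] assms(2) by (auto simp: m_assoc)
  then show "\<exists>j\<in>J. X #> y = X #> j" using xj(2) by blast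
next
  assume "\<exists>j\<in>J. X #> y = X #> j"
  then obtain j where j: "j \<in> J" "X #> y = X #> j" by blast
  have jc: "j \<in> carrier G" using j(1) assms(2) by blast
  have "y \<otimes> inv j \<in> X" using j(2) r_coset_eq_iff[OF assms(1,3) jc] by simp
  moreover have "y = (y \<otimes> inv j) \<otimes> j" using assms(3) jc by (simp add: m_assoc)
  ultimately show "y \<in> X <#> J" using j(1) unfolding set_mult_def by blast
qed

lemma normal_set_mult:
  assumes "A \<lhd> G" "B \<lhd> G"
  shows "A <#> B \<lhd> G"
proof -
  have A: "subgroup A G" and B: "subgroup B G" using assms normal_imp_subgroup by auto
  have "conjg G g x \<in> A <#> B" if g: "g \<in> carrier G" and x: "x \<in> A <#> B" for g x
  proof -
    obtain a b where ab: "a \<in> A" "b \<in> B" "x = a \<otimes> b" using x by (auto simp: set_mult_def)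
    have "conjg G g x = conjg G g a \<otimes> conjg G g b"
      using g ab conjg_mult subgroup.mem_carrier[OF A] subgroup.mem_carrier[OF B] by simp
    then show ?thesis using ab g assms unfolding normal_conjg_iff set_mult_def by blast
  qed
  then show ?thesis using mult_norm_subgroup[OF assms(1) B] by (simp add: normal_conjg_iff)
qed

text \<open>An elementwise modular law: l j^-1 lies in both L and X, hence in J.\<close>

lemma mem_of_congruent:
  assumes "subgroup X G" "subgroup L G" "subgroup J G" "J \<subseteq> L" "L \<inter> X \<subseteq> J"
    and "l \<in> L" "j \<in> J" "X #> l = X #> j"
  shows "l \<in> J"
proof -
  have c: "l \<in> carrier G" "j \<in> carrier G"
    using subgroup.mem_carrier[OF assms(2,6)] subgroup.mem_carrier[OF assms(3,7)] by auto
  have "l \<otimes> inv j \<in> X" using assms(8) r_coset_eq_iff[OF assms(1) c] by simp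
  moreover have "l \<otimes> inv j \<in> L"
    using subgroup.m_closed[OF assms(2,6) subgroup.m_inv_closed[OF assms(2)]] assms(4,7) by blast
  ultimately have "l \<otimes> inv j \<in> J" using assms(5) by blast
  then have "(l \<otimes> inv j) \<otimes> j \<in> J" using subgroup.m_closed[OF assms(3) _ assms(7)] by blast
  then show ?thesis using c by (simp add: m_assoc)
qed

end

context finite_group
begin

text \<open>The coset conditions say that L X = H X and M X = K X. Since H meets X inside K and L
  meets X inside M, both H/K and L/M are isomorphic to H X/K X, compatibly with conjugation. So L/M
  is again a chief factor, and a generator of it can be carried back to H/K.\<close>

lemma perspective_chief_cyclic:
  assumes chief: "chief_factor G H K"
    and n: "L \<lhd> G" "M \<lhd> G" "X \<lhd> G" "M \<subseteq> L"
    and LH: "\<And>l. l \<in> L \<Longrightarrow> \<exists>h\<in>H. X #> l = X #> h"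
    and HL: "\<And>h. h \<in> H \<Longrightarrow> \<exists>l\<in>L. X #> h = X #> l"
    and MK: "\<And>m. m \<in> M \<Longrightarrow> \<exists>k\<in>K. X #> m = X #> k"
    and KM: "\<And>k. k \<in> K \<Longrightarrow> \<exists>m\<in>M. X #> k = X #> m"
    and HX: "H \<inter> X \<subseteq> K" and LX: "L \<inter> X \<subseteq> M"
    and cyc: "chief_factor G L M \<Longrightarrow> cyclic_group (subgp G L Mod M)"
  shows "cyclic_group (subgp G H Mod K)"
proof -
  have nH: "H \<lhd> G" and nK: "K \<lhd> G" and KH: "K \<subset> H"
    and minimal: "\<And>J. \<lbrakk>J \<lhd> G; K \<subseteq> J; J \<subseteq> H\<rbrakk> \<Longrightarrow> J = K \<or> J = H"
    using chief unfolding chief_factor_def by blast+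
  note s = n(1,2,3)[THEN normal_imp_subgroup] nH[THEN normal_imp_subgroup] nK[THEN normal_imp_subgroup]
  note c = s[THEN subgroup.subset]
  have "chief_factor G L M"
    unfolding chief_factor_def
  proof (intro conjI n psubsetI notI)
    assume eq: "M = L"
    have "h \<in> K" if h: "h \<in> H" for h
    proof -
      obtain l where "l \<in> L" "X #> h = X #> l" using HL[OF h] by blast
      moreover from this obtain k where "k \<in> K" "X #> l = X #> k" using MK eq by blast
      ultimately show ?thesis using mem_of_congruent[OF s(3,4,5) _ HX h, of k] KH by simp
    qed
    then show False using KH by blast
  next
    assume "\<exists>J. J \<lhd> G \<and> M \<subset> J \<and> J \<subset> L"
    then obtain J where J: "J \<lhd> G" "M \<subset> J" "J \<subset> L" by blast
    have Js: "subgroup J G" using normal_imp_subgroup[OF J(1)] .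
    \<comment> \<open>The counterpart in H of an intermediate J. As H/K is chief it is K or H, which
      pushes J down to M or up to L.\<close>
    let ?J = "(X <#> J) \<inter> H"
    have memJ: "h \<in> ?J \<longleftrightarrow> (\<exists>j\<in>J. X #> h = X #> j)" if "h \<in> H" for h
      using mem_set_mult_iff[OF s(3) subgroup.subset[OF Js], of h] that c(4) by blast
    have "?J \<lhd> G" using normal_subgroup_intersect[OF normal_set_mult[OF n(3) J(1)] nH] .
    moreover have "K \<subseteq> ?J"
    proof
      fix k assume k: "k \<in> K"
      then show "k \<in> ?J" using KM[OF k] J(2) memJ KH by blast
    qed
    ultimately have "?J = K \<or> ?J = H" using minimal by blast
    then show False
    proof
      assume e: "?J = K"
      have "j \<in> M" if j: "j \<in> J" for j
      proof -
        obtain h where h: "h \<in> H" "X #> j = X #> h" using LH j J(3) by blast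
        then have "h \<in> ?J" using memJ[OF h(1)] j by metis
        then obtain m where "m \<in> M" "X #> h = X #> m" using e KM by blast
        then show ?thesis using mem_of_congruent[OF s(3,1,2) n(4) LX, of j m] h j J(3) by auto
      qed
      then show False using J(2) by blast
    next
      assume e: "?J = H"
      have "l \<in> J" if l: "l \<in> L" for l
      proof -
        obtain h where h: "h \<in> H" "X #> l = X #> h" using LH l by blast
        then obtain j where "j \<in> J" "X #> h = X #> j" using e memJ[OF h(1)] by blast
        then show ?thesis using mem_of_congruent[OF s(3,1) Js _ _ l, of j] h J LX by auto
      qed
      then show False using J(3) by blast
    qed
  qed
  then have "cyclic_group (subgp G L Mod M)" using cyc by blast
  then obtain u where u: "u \<in> L" "\<And>l. l \<in> L \<Longrightarrow> \<exists>k::int. l \<in> M #> u [^] k"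
    using cyclic_factor_iff[OF n(2) s(1) n(4)] by blast
  \<comment> \<open>The element x of H that agrees modulo X with the generator u of L/M will
    generate H/K.\<close>
  obtain x where x: "x \<in> H" "X #> u = X #> x" using LH u(1) by blast
  have uc: "u \<in> carrier G" and xc: "x \<in> carrier G" using u x c by auto
  have pw: "X #> u [^] k = X #> x [^] k" for k :: int
    using normal.FactGroup_int_pow[OF n(3) uc, of k] normal.FactGroup_int_pow[OF n(3) xc, of k] x(2) by simp
  interpret X: normal X G using n(3) .
  have "\<exists>k::int. y \<in> K #> x [^] k" if y: "y \<in> H" for y
  proof -
    have yc: "y \<in> carrier G" using y c(4) by blast
    obtain l where l: "l \<in> L" "X #> y = X #> l" using HL[OF y] by blast
    obtain k :: int where "l \<in> M #> u [^] k" using u(2) l(1) by blast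
    then obtain m where m: "m \<in> M" "l = m \<otimes> u [^] k" by (auto simp: r_coset_def)
    obtain a where a: "a \<in> K" "X #> m = X #> a" using MK[OF m(1)] by blast
    have ac: "a \<in> carrier G" and mc: "m \<in> carrier G" using a m c by auto
    have "X #> y = X #> (m \<otimes> u [^] k)" using l m by simp
    also have "\<dots> = (X #> m) <#> (X #> u [^] k)" using X.rcos_sum mc uc by simp
    also have "\<dots> = (X #> a) <#> (X #> x [^] k)" using a(2) pw by simp
    also have "\<dots> = X #> (a \<otimes> x [^] k)" using X.rcos_sum ac xc by simp
    finally have yX: "X #> y = X #> (a \<otimes> x [^] k)" .
    have xk: "x [^] k \<in> H" using subgroup_int_pow_closed[OF s(4) x(1)] .
    have ax: "a \<otimes> x [^] k \<in> K #> x [^] k" using a(1) by (auto simp: r_coset_def)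
    \<comment> \<open>Modulo X, y equals a x^k with a in K. The discrepancy lies in both H and X,
      hence in K.\<close>
    have "y \<otimes> inv (a \<otimes> x [^] k) \<in> X" using yX r_coset_eq_iff[OF s(3) yc] ac xc by simp
    moreover have "y \<otimes> inv (a \<otimes> x [^] k) \<in> H"
      using subgroup.m_closed[OF s(4) y subgroup.m_inv_closed[OF s(4) subgroup.m_closed[OF s(4) _ xk]]] a(1) KH by blast
    ultimately have "y \<otimes> inv (a \<otimes> x [^] k) \<in> K" using HX by blast
    then have "K #> y = K #> (a \<otimes> x [^] k)" using r_coset_eq_iff[OF s(5) yc] ac xc by simp
    also have "\<dots> = K #> x [^] k" using repr_independence[OF ax _ s(5)] xc by simp
    finally have "y \<in> K #> x [^] k" using rcos_self[OF yc s(5)] by simp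
    then show ?thesis by blast
  qed
  then show ?thesis using cyclic_factor_iff[OF nK s(4)] KH x(1) by blast
qed

text \<open>Names the condition under \<open>GREATEST\<close> in
  \<open>supersolvable_hypercenter\<close>.\<close>

definition hypercentral :: "'a set \<Rightarrow> bool"
  where "hypercentral N \<longleftrightarrow> N \<lhd> G \<and>
    (\<forall>H K. chief_factor G H K \<and> H \<subseteq> N \<longrightarrow> cyclic_group (subgp G H Mod K))"

text \<open>For a chief factor H/K below the product, the normal subgroup
  \<open>K <#> (H \<inter> N1)\<close> is H or K. If it is H, then H/K is perspective modulo K to a
  factor inside N1. If it is K, then H meets N1 inside K, and H/K is perspective modulo N1 to a
  factor inside N2.\<close>

lemma hypercentral_set_mult:
  assumes "hypercentral N1" "hypercentral N2"
  shows "hypercentral (N1 <#> N2)"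
  unfolding hypercentral_def
proof (intro conjI allI impI; (elim conjE)?)
  have n: "N1 \<lhd> G" "N2 \<lhd> G" using assms by (simp_all add: hypercentral_def)
  then show "N1 <#> N2 \<lhd> G" by (rule normal_set_mult)
  note s = n[THEN normal_imp_subgroup]
  fix H K assume chief: "chief_factor G H K" and H: "H \<subseteq> N1 <#> N2"
  have nH: "H \<lhd> G" and nK: "K \<lhd> G" and KH: "K \<subset> H"
    and minimal: "\<And>J. \<lbrakk>J \<lhd> G; K \<subseteq> J; J \<subseteq> H\<rbrakk> \<Longrightarrow> J = K \<or> J = H"
    using chief unfolding chief_factor_def by blast+
  note sHK = nH[THEN normal_imp_subgroup] nK[THEN normal_imp_subgroup]
  note c = s[THEN subgroup.subset] sHK[THEN subgroup.subset]
  let ?A = "H \<inter> N1"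
  have nA: "?A \<lhd> G" using normal_subgroup_intersect[OF nH n(1)] .
  have memA: "y \<in> K <#> ?A \<longleftrightarrow> (\<exists>j\<in>?A. K #> y = K #> j)" if "y \<in> carrier G" for y
    using mem_set_mult_iff[OF sHK(2) _ that, of ?A] c(1) by blast
  have KA: "K \<subseteq> K <#> ?A"
  proof
    fix k assume k: "k \<in> K"
    have "K #> k = K #> \<one>" using coset_join2[OF _ sHK(2) k] c k by auto
    moreover have "\<one> \<in> ?A" using subgroup.one_closed sHK(1) s(1) by blast
    ultimately show "k \<in> K <#> ?A" using memA[of k] c k by blast
  qed
  have "K <#> ?A \<subseteq> H" using KH subgroup.m_closed[OF sHK(1)] by (auto simp: set_mult_def)
  then have "K <#> ?A = K \<or> K <#> ?A = H" using minimal[OF normal_set_mult[OF nK nA] KA] by blast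
  then show "cyclic_group (subgp G H Mod K)"
  proof
    assume e: "K <#> ?A = H"
    show ?thesis
    proof (rule perspective_chief_cyclic[OF chief nA _ nK])
      show "K \<inter> N1 \<lhd> G" using normal_subgroup_intersect[OF nK n(1)] .
      show "K \<inter> N1 \<subseteq> ?A" using KH by blast
      show "\<exists>l\<in>?A. K #> h = K #> l" if "h \<in> H" for h using memA[of h] e that c by blast
      show "\<exists>m\<in>K \<inter> N1. K #> k = K #> m" if k: "k \<in> K" for k
      proof -
        have "K #> k = K #> \<one>" using coset_join2[OF _ sHK(2) k] c k by auto
        moreover have "\<one> \<in> K \<inter> N1" using subgroup.one_closed sHK(2) s(1) by blast
        ultimately show ?thesis by blast
      qed
      show "cyclic_group (subgp G ?A Mod (K \<inter> N1))" if "chief_factor G ?A (K \<inter> N1)"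
        using assms(1) that by (auto simp: hypercentral_def)
    qed auto
  next
    assume e: "K <#> ?A = K"
    have HN: "H \<inter> N1 \<subseteq> K"
    proof
      fix x assume x: "x \<in> H \<inter> N1"
      then have "x \<in> K <#> ?A" using memA[of x] c by blast
      then show "x \<in> K" using e by simp
    qed
    let ?L = "(N1 <#> H) \<inter> N2" and ?M = "(N1 <#> K) \<inter> N2"
    have mem: "y \<in> N1 <#> Y \<longleftrightarrow> (\<exists>j\<in>Y. N1 #> y = N1 #> j)" if "y \<in> carrier G" "Y \<subseteq> carrier G" for y Y
      using mem_set_mult_iff[OF s(1) that(2,1)] .
    have into: "\<exists>l\<in>(N1 <#> Y) \<inter> N2. N1 #> y = N1 #> l" if Y: "Y \<subseteq> H" and y: "y \<in> Y" for Y y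
    proof -
      have yc: "y \<in> carrier G" and Yc: "Y \<subseteq> carrier G" using that c by auto
      obtain l where l: "l \<in> N2" "N1 #> y = N1 #> l" using mem[OF yc c(2)] Y y H by blast
      then have "l \<in> N1 <#> Y" using mem[OF _ Yc, of l] y c(2) by force
      then show ?thesis using l by blast
    qed
    show ?thesis
    proof (rule perspective_chief_cyclic[OF chief _ _ n(1)])
      show "?L \<lhd> G" "?M \<lhd> G"
        using normal_subgroup_intersect[OF normal_set_mult[OF n(1) nH] n(2)]
          normal_subgroup_intersect[OF normal_set_mult[OF n(1) nK] n(2)] by auto
      show "?M \<subseteq> ?L" using KH by (auto simp: set_mult_def)
      show "\<exists>h\<in>H. N1 #> l = N1 #> h" if "l \<in> ?L" for l using that mem[of l H] c by blast
      show "\<exists>k\<in>K. N1 #> l = N1 #> k" if "l \<in> ?M" for l using that mem[of l K] c by blast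
      show "\<exists>l\<in>?L. N1 #> h = N1 #> l" if "h \<in> H" for h using into[OF _ that] by blast
      show "\<exists>l\<in>?M. N1 #> h = N1 #> l" if "h \<in> K" for h using into[OF _ that] KH by blast
      show "H \<inter> N1 \<subseteq> K" by (rule HN)
      show "?L \<inter> N1 \<subseteq> ?M"
      proof
        fix l assume l: "l \<in> ?L \<inter> N1"
        then have "N1 #> l = N1 #> \<one>" using coset_join2[OF _ s(1), of l] c by auto
        then show "l \<in> ?M" using l mem[OF _ c(4), of l] subgroup.one_closed[OF sHK(2)] c(2) by blast
      qed
      show "cyclic_group (subgp G ?L Mod ?M)" if "chief_factor G ?L ?M"
        using assms(2) that by (auto simp: hypercentral_def)
    qed
  qed
qed

lemma hypercentral_one: "hypercentral {\<one>}"
  unfolding hypercentral_def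
proof (intro conjI allI impI one_is_normal; elim conjE)
  fix H K assume "chief_factor G H K" "H \<subseteq> {\<one>}"
  then have "K \<lhd> G" "K \<subset> {\<one>}" by (auto simp: chief_factor_def)
  then show "cyclic_group (subgp G H Mod K)" using subgroup.one_closed[OF normal_imp_subgroup] by blast
qed

text \<open>By finiteness there is a maximal candidate M. Its product with any other candidate is a
  candidate containing both, so M is the largest and \<open>GREATEST\<close> denotes it.\<close>

lemma hypercentral_hypercenter: "hypercentral (supersolvable_hypercenter G)"
proof -
  have "{N. hypercentral N} \<subseteq> Pow (carrier G)"
    unfolding hypercentral_def using normal_imp_subgroup[THEN subgroup.subset] by auto
  then have fs: "finite {N. hypercentral N}" using fin finite_subset by blast
  then obtain M where M: "hypercentral M" "\<And>N. hypercentral N \<Longrightarrow> \<not> M \<subset> N"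
    using hypercentral_one finite_has_maximal[OF fs] by blast
  have "N \<subseteq> M" if N: "hypercentral N" for N
  proof -
    have s: "subgroup M G" "subgroup N G" using M(1) N normal_imp_subgroup by (auto simp: hypercentral_def)
    have "m \<otimes> \<one> \<in> M <#> N" if "m \<in> M" for m
      using that subgroup.one_closed[OF s(2)] unfolding set_mult_def by blast
    then have "M \<subseteq> M <#> N" using subgroup.mem_carrier[OF s(1)] by auto
    moreover have "\<one> \<otimes> x \<in> M <#> N" if "x \<in> N" for x
      using that subgroup.one_closed[OF s(1)] unfolding set_mult_def by blast
    then have "N \<subseteq> M <#> N" using subgroup.mem_carrier[OF s(2)] by auto
    ultimately show ?thesis using M(2)[OF hypercentral_set_mult[OF M(1) N]] by blast
  qed
  then have "supersolvable_hypercenter G = M"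
    using M(1) Greatest_subset[of hypercentral M]
    unfolding supersolvable_hypercenter_def hypercentral_def by simp
  then show ?thesis using M(1) by simp
qed

section \<open>Action on chief factors\<close>

lemma chief_factor_below:
  assumes "A \<lhd> G" "A \<noteq> {\<one>}"
  shows "\<exists>B. chief_factor G A B"
proof -
  have "{B. B \<lhd> G \<and> B \<subset> A} \<subseteq> Pow (carrier G)"
    using normal_imp_subgroup[THEN subgroup.subset] by auto
  then have f: "finite {B. B \<lhd> G \<and> B \<subset> A}" using fin finite_subset by blast
  have "{\<one>} \<subset> A" using assms subgroup.one_closed[OF normal_imp_subgroup] by blast
  then have "{B. B \<lhd> G \<and> B \<subset> A} \<noteq> {}" using one_is_normal by blast
  from finite_has_maximal[OF f this] obtain B where "B \<lhd> G" "B \<subset> A" "\<And>L. L \<lhd> G \<Longrightarrow> L \<subset> A \<Longrightarrow> B \<subseteq> L \<Longrightarrow> B = L"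
    by auto
  then show ?thesis using assms(1) unfolding chief_factor_def by blast
qed

lemma conjg_int_pow:
  "\<lbrakk>g \<in> carrier G; x \<in> carrier G\<rbrakk> \<Longrightarrow> conjg G g (x [^] (k::int)) = conjg G g x [^] k"
  using group_hom.hom_int_pow[OF conjg_hom] by simp

lemma r_coset_conjg_cong:
  assumes "B \<lhd> G" "g \<in> carrier G" "a \<in> carrier G" "b \<in> carrier G" "B #> a = B #> b"
  shows "B #> conjg G g a = B #> conjg G g b"
proof -
  have B: "subgroup B G" using normal_imp_subgroup[OF assms(1)] .
  have "a \<otimes> inv b \<in> B" using assms r_coset_eq_iff[OF B] by simp
  then have "conjg G g (a \<otimes> inv b) \<in> B" using assms(1,2) by (simp add: normal_conjg_iff)
  moreover have "conjg G g (a \<otimes> inv b) = conjg G g a \<otimes> inv (conjg G g b)"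
    using assms(2-4) conjg_mult group_hom.hom_inv[OF conjg_hom] by simp
  ultimately show ?thesis using assms(2-4) r_coset_eq_iff[OF B] by simp
qed

lemma pow_card_subgroup:
  assumes "subgroup H G" "x \<in> H"
  shows "x [^] card H = \<one>"
proof -
  interpret H: finite_group "subgp G H" using finite_group_subgp[OF assms(1)] .
  have "x [^]\<^bsub>subgp G H\<^esub> order (subgp G H) = \<one>\<^bsub>subgp G H\<^esub>"
    using H.pow_order_eq_1 assms(2) by simp
  then show ?thesis by (simp add: order_def nat_pow_consistent[symmetric])
qed

text \<open>The elements of A congruent modulo B to a p-th power form a normal subgroup between B and A;
  it is not A because a generator of A/B has p-power order.\<close>

lemma cyclic_chief_factor_card:
  assumes "prime p" "chief_factor G A B" "A \<subseteq> P" "subgroup P G" "card P = p ^ n"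
    and "cyclic_group (subgp G A Mod B)"
  shows "card ((\<lambda>x. B #> x) ` A) \<le> p"
proof -
  have nA: "A \<lhd> G" and nB: "B \<lhd> G" and BA: "B \<subset> A"
    and minimal: "\<And>J. \<lbrakk>J \<lhd> G; B \<subseteq> J; J \<subseteq> A\<rbrakk> \<Longrightarrow> J = B \<or> J = A"
    using assms(2) unfolding chief_factor_def by blast+
  note s = nA[THEN normal_imp_subgroup] nB[THEN normal_imp_subgroup]
  have Ac: "a \<in> carrier G" if "a \<in> A" for a using subgroup.mem_carrier[OF s(1) that] .
  interpret B: normal B G using nB .
  interpret Q: group "G Mod B" using B.factorgroup_is_group .
  obtain u where u: "u \<in> A" "\<And>y. y \<in> A \<Longrightarrow> \<exists>k::int. y \<in> B #> u [^] k"
    using cyclic_factor_iff[OF nB s(1)] assms(6) BA by blast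
  have uc: "u \<in> carrier G" using Ac u(1) .
  let ?q = "B #> u"
  have q: "?q \<in> carrier (G Mod B)" using uc by (simp add: carrier_FactGroup)
  have pw: "B #> x [^] k = (B #> x) [^]\<^bsub>G Mod B\<^esub> k" if "x \<in> carrier G" for x and k :: int
    using B.FactGroup_int_pow[OF that, of k] by simp
  have ml: "B #> (x \<otimes> y) = (B #> x) \<otimes>\<^bsub>G Mod B\<^esub> (B #> y)" if "x \<in> carrier G" "y \<in> carrier G" for x y
    using B.rcos_sum that by simp
  have gen: "\<exists>k::int. B #> y = ?q [^]\<^bsub>G Mod B\<^esub> k" if y: "y \<in> A" for y
  proof -
    obtain k :: int where "y \<in> B #> u [^] k" using u(2) y by blast
    then have "B #> u [^] k = B #> y" using repr_independence[OF _ _ s(2)] uc by simp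
    then show ?thesis using pw[OF uc] by metis
  qed
  have one_pow: "B [^]\<^bsub>G Mod B\<^esub> k = B" for k :: int using Q.int_pow_one[of k] by (simp del: Q.int_pow_one)
  let ?C = "{x \<in> A. \<exists>k::int. B #> x = ?q [^]\<^bsub>G Mod B\<^esub> (int p * k)}"
  have Csub: "subgroup ?C G"
  proof (rule subgroupI)
    show "?C \<subseteq> carrier G" using Ac by blast
    have "B #> \<one> = ?q [^]\<^bsub>G Mod B\<^esub> (int p * 0)" using B.subset by simp
    then show "?C \<noteq> {}" using subgroup.one_closed[OF s(1)] by blast
    fix a b assume a: "a \<in> ?C"
    then obtain k :: int where k: "B #> a = ?q [^]\<^bsub>G Mod B\<^esub> (int p * k)" and aA: "a \<in> A" by blast
    have "inv a = a [^] (-1::int)" using Ac[OF aA] int_pow_neg[of a 1] by simp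
    then have "B #> inv a = (?q [^]\<^bsub>G Mod B\<^esub> (int p * k)) [^]\<^bsub>G Mod B\<^esub> (-1::int)"
      using pw[OF Ac[OF aA]] k by metis
    also have "\<dots> = ?q [^]\<^bsub>G Mod B\<^esub> (int p * (-k))" using Q.int_pow_pow[OF q] by simp
    finally show "inv a \<in> ?C" using subgroup.m_inv_closed[OF s(1) aA] by blast
    assume b: "b \<in> ?C"
    then obtain l :: int where l: "B #> b = ?q [^]\<^bsub>G Mod B\<^esub> (int p * l)" and bA: "b \<in> A" by blast
    have "B #> (a \<otimes> b) = ?q [^]\<^bsub>G Mod B\<^esub> (int p * k) \<otimes>\<^bsub>G Mod B\<^esub> ?q [^]\<^bsub>G Mod B\<^esub> (int p * l)"
      using ml[OF Ac[OF aA] Ac[OF bA]] k l by simp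
    also have "\<dots> = ?q [^]\<^bsub>G Mod B\<^esub> (int p * (k + l))" using Q.int_pow_mult[OF q] by (simp add: distrib_left)
    finally show "a \<otimes> b \<in> ?C" using subgroup.m_closed[OF s(1) aA bA] by blast
  qed
  have "conjg G g x \<in> ?C" if g: "g \<in> carrier G" and x: "x \<in> ?C" for g x
  proof -
    obtain k :: int where k: "B #> x = ?q [^]\<^bsub>G Mod B\<^esub> (int p * k)" and xA: "x \<in> A" using x by blast
    have cA: "conjg G g y \<in> A" if "y \<in> A" for y using g nA that by (simp add: normal_conjg_iff)
    \<comment> \<open>Modulo B the conjugate u^g is itself a power of the generator u, so
      conjugation preserves exponents divisible by p.\<close>
    obtain j :: int where j: "B #> conjg G g u = ?q [^]\<^bsub>G Mod B\<^esub> j" using gen[OF cA[OF u(1)]] by blast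
    have "B #> x = B #> u [^] (int p * k)" using k pw[OF uc] by simp
    then have "B #> conjg G g x = B #> conjg G g (u [^] (int p * k))"
      using r_coset_conjg_cong[OF nB g Ac[OF xA]] uc by simp
    also have "\<dots> = (B #> conjg G g u) [^]\<^bsub>G Mod B\<^esub> (int p * k)" using conjg_int_pow[OF g uc] pw g uc by simp
    also have "\<dots> = ?q [^]\<^bsub>G Mod B\<^esub> (int p * (j * k))" using j Q.int_pow_pow[OF q] by (simp add: mult_ac)
    finally show ?thesis using cA[OF xA] by blast
  qed
  then have nC: "?C \<lhd> G" using Csub unfolding normal_conjg_iff by blast
  have "B #> b = ?q [^]\<^bsub>G Mod B\<^esub> (int p * 0)" if "b \<in> B" for b
    using coset_join2[OF _ s(2) that] subgroup.mem_carrier[OF s(2) that] by simp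
  then have BC: "B \<subseteq> ?C" using BA by blast
  have "?C \<noteq> A"
  proof
    assume "?C = A"
    then obtain k :: int where k: "?q = ?q [^]\<^bsub>G Mod B\<^esub> (int p * k)" using u(1) by blast
    \<comment> \<open>Iterating q = q^(p k) yields q = q^((p k)^n), which is trivial because u^(p^n)
      = 1. Then A/B would be trivial.\<close>
    have it: "?q = ?q [^]\<^bsub>G Mod B\<^esub> ((int p * k) ^ j)" for j :: nat
    proof (induction j)
      case 0 then show ?case using q by simp
    next
      case (Suc j)
      have "?q = (?q [^]\<^bsub>G Mod B\<^esub> ((int p * k) ^ j)) [^]\<^bsub>G Mod B\<^esub> (int p * k)" using Suc k by simp
      then show ?case using Q.int_pow_pow[OF q] by (simp add: mult_ac)
    qed
    have "u [^] (p ^ n) = \<one>" using pow_card_subgroup[OF assms(4)] assms(3,5) u(1) by (metis subsetD)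
    then have "u [^] (int p ^ n) = \<one>" using int_pow_int[of G u "p ^ n"] by simp
    then have "?q [^]\<^bsub>G Mod B\<^esub> (int p ^ n) = B" using pw[OF uc] B.subset by (metis coset_mult_one)
    then have "?q [^]\<^bsub>G Mod B\<^esub> ((int p * k) ^ n) = \<one>\<^bsub>G Mod B\<^esub>"
      using Q.int_pow_pow[OF q, of "int p ^ n" "k ^ n"] by (simp add: power_mult_distrib one_pow)
    then have q1: "?q = B" using it[of n] by simp
    have "y \<in> B" if y: "y \<in> A" for y
    proof -
      obtain k :: int where "B #> y = ?q [^]\<^bsub>G Mod B\<^esub> k" using gen y by blast
      also have "\<dots> = B" using q1 one_pow by simp
      finally show ?thesis using rcos_self[OF Ac[OF y] s(2)] by simp
    qed
    then show False using BA by blast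
  qed
  then have CB: "?C = B" using minimal[OF nC BC] by blast
  \<comment> \<open>Since \<open>?C\<close> has collapsed to B, the generator has p-th power 1
    modulo B, and exponents can be reduced modulo p.\<close>
  have "u [^] int p \<in> ?C"
    using subgroup_int_pow_closed[OF s(1) u(1)] pw[OF uc, of "int p"] by (auto intro!: exI[of _ 1])
  then have "u [^] int p \<in> B" using CB by simp
  then have qp: "?q [^]\<^bsub>G Mod B\<^esub> int p = \<one>\<^bsub>G Mod B\<^esub>"
    using pw[OF uc, of "int p"] coset_join2[OF _ s(2)] uc by simp
  have "(\<lambda>x. B #> x) ` A \<subseteq> (\<lambda>k. ?q [^]\<^bsub>G Mod B\<^esub> int k) ` {..<p}"
  proof
    fix c assume "c \<in> (\<lambda>x. B #> x) ` A"
    then obtain k :: int where k: "c = ?q [^]\<^bsub>G Mod B\<^esub> k" using gen by auto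
    have "?q [^]\<^bsub>G Mod B\<^esub> k = ?q [^]\<^bsub>G Mod B\<^esub> (int p * (k div int p) + k mod int p)" by simp
    also have "\<dots> = (?q [^]\<^bsub>G Mod B\<^esub> int p) [^]\<^bsub>G Mod B\<^esub> (k div int p) \<otimes>\<^bsub>G Mod B\<^esub> ?q [^]\<^bsub>G Mod B\<^esub> (k mod int p)"
      by (simp only: Q.int_pow_mult[OF q] Q.int_pow_pow[OF q])
    also have "\<dots> = ?q [^]\<^bsub>G Mod B\<^esub> int (nat (k mod int p))"
      using qp one_pow Q.l_one[OF Q.int_pow_closed[OF q]] prime_gt_0_nat[OF assms(1)] by simp
    finally have "c = ?q [^]\<^bsub>G Mod B\<^esub> int (nat (k mod int p))" using k by simp
    moreover have "nat (k mod int p) < p" using prime_gt_0_nat[OF assms(1)] by (simp add: nat_less_iff)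
    ultimately show "c \<in> (\<lambda>k. ?q [^]\<^bsub>G Mod B\<^esub> int k) ` {..<p}" by blast
  qed
  then show ?thesis using card_image_le[of "{..<p}"] card_mono[OF finite_imageI[of "{..<p}"]]
    by (metis card_lessThan finite_lessThan le_trans)
qed

lemma conjg_r_coset:
  assumes "B \<lhd> G" "g \<in> carrier G" "x \<in> carrier G"
  shows "conjg G g ` (B #> x) = B #> conjg G g x"
proof -
  have Bc: "b \<in> carrier G" if "b \<in> B" for b
    using subgroup.mem_carrier[OF normal_imp_subgroup[OF assms(1)] that] .
  have "conjg G g ` (B #> x) = (\<Union>b\<in>B. {conjg G g (b \<otimes> x)})" by (auto simp: r_coset_def)
  also have "\<dots> = (\<Union>b\<in>B. {conjg G g b \<otimes> conjg G g x})" using assms(2,3) Bc by (simp add: conjg_mult)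
  also have "\<dots> = conjg G g ` B #> conjg G g x" by (auto simp: r_coset_def)
  finally show ?thesis using normal_conjg_image[OF assms(1,2)] by simp
qed

text \<open>Conjugation on A/B, again with an inverse to obtain a left action; it makes the count of
  moved points available for chief factors.\<close>

lemma conjg_coset_action:
  assumes "A \<lhd> G" "B \<lhd> G" "subgroup R G"
  shows "group_action (subgp G R) ((\<lambda>x. B #> x) ` A) (\<lambda>r. \<lambda>c \<in> (\<lambda>x. B #> x) ` A. conjg G (inv r) ` c)"
proof -
  let ?E = "(\<lambda>x. B #> x) ` A"
  let ?\<phi> = "\<lambda>r. \<lambda>c \<in> ?E. conjg G (inv r) ` c"
  have R: "r \<in> carrier G" if "r \<in> R" for r using subgroup.mem_carrier[OF assms(3) that] .
  have Ac: "x \<in> carrier G" if "x \<in> A" for x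
    using subgroup.mem_carrier[OF normal_imp_subgroup[OF assms(1)] that] .
  have Bc: "B \<subseteq> carrier G" using subgroup.subset[OF normal_imp_subgroup[OF assms(2)]] .
  have sub: "c \<subseteq> carrier G" if "c \<in> ?E" for c
    using that r_coset_subset_G[OF Bc Ac] by blast
  have cl: "conjg G g ` c \<in> ?E" if g: "g \<in> carrier G" and c: "c \<in> ?E" for g c
  proof -
    obtain x where x: "x \<in> A" "c = B #> x" using c by blast
    then have "conjg G g ` c = B #> conjg G g x" using conjg_r_coset[OF assms(2) g Ac] by simp
    moreover have "conjg G g x \<in> A" using assms(1) g x(1) by (simp add: normal_conjg_iff)
    ultimately show ?thesis by blast
  qed
  have bij: "?\<phi> r \<in> carrier (BijGroup ?E)" if "r \<in> R" for r
  proof -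
    have "bij_betw (?\<phi> r) ?E ?E"
    proof (rule bij_betw_byWitness[where f' = "\<lambda>c. conjg G r ` c"])
      show "\<forall>c\<in>?E. conjg G r ` ?\<phi> r c = c" using R[OF that] sub conjg_image_inv(2) by (simp del: image_iff)
      show "\<forall>c\<in>?E. ?\<phi> r (conjg G r ` c) = c"
        using R[OF that] sub cl[OF R[OF that]] conjg_image_inv(1)[OF R[OF that]] by (simp del: image_iff)
      show "?\<phi> r ` ?E \<subseteq> ?E" using cl[of "inv r"] R[OF that] by (simp add: image_subset_iff)
      show "(\<lambda>c. conjg G r ` c) ` ?E \<subseteq> ?E" using cl[OF R[OF that]] by blast
    qed
    then show ?thesis by (simp add: BijGroup_def Bij_def)
  qed
  have "?\<phi> (g \<otimes> h) = ?\<phi> g \<otimes>\<^bsub>BijGroup ?E\<^esub> ?\<phi> h" if g: "g \<in> R" and h: "h \<in> R" for g h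
  proof -
    have "?\<phi> g \<otimes>\<^bsub>BijGroup ?E\<^esub> ?\<phi> h = compose ?E (?\<phi> g) (?\<phi> h)"
      using bij[OF g] bij[OF h] by (simp add: BijGroup_def)
    also have "\<dots> = ?\<phi> (g \<otimes> h)"
    proof
      fix c
      show "compose ?E (?\<phi> g) (?\<phi> h) c = ?\<phi> (g \<otimes> h) c"
      proof (cases "c \<in> ?E")
        case True
        have "conjg G (inv h) ` c \<in> ?E" using cl[OF inv_closed[OF R[OF h]] True] .
        then show ?thesis
          using True conjg_image_conjg[OF _ _ sub[OF True], of "inv h" "inv g"] R[OF g] R[OF h]
          by (simp add: compose_def inv_mult_group del: image_iff)
      next
        case False
        then show ?thesis by (simp add: compose_def del: image_iff)
      qed
    qed
    finally show ?thesis by simp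
  qed
  then have "?\<phi> \<in> hom (subgp G R) (BijGroup ?E)"
    using bij by (auto simp: hom_def)
  then show ?thesis
    unfolding group_action_def group_hom_def group_hom_axioms_def
    using group_BijGroup subgroup_imp_group[OF assms(3)] by blast
qed

definition chief_centralizer :: "'a set \<Rightarrow> 'a set"
  where "chief_centralizer P = {g \<in> carrier G.
    \<forall>A B. chief_factor G A B \<and> A \<subseteq> P \<longrightarrow> (\<forall>x\<in>A. B #> conjg G g x = B #> x)}"

lemma chief_centralizer_normal: "chief_centralizer P \<lhd> G"
proof -
  let ?E = "chief_centralizer P"
  have EI: "g \<in> ?E" if "g \<in> carrier G"
    "\<And>A B x. \<lbrakk>A \<lhd> G; B \<lhd> G; chief_factor G A B; A \<subseteq> P; x \<in> A; x \<in> carrier G\<rbrakk> \<Longrightarrow> B #> conjg G g x = B #> x" for g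
    unfolding chief_centralizer_def
  proof (intro CollectI conjI allI impI ballI that(1); elim conjE)
    fix A B x assume c: "chief_factor G A B" "A \<subseteq> P" and x: "x \<in> A"
    then have n: "A \<lhd> G" "B \<lhd> G" by (simp_all add: chief_factor_def)
    show "B #> conjg G g x = B #> x"
      using that(2)[OF n c x subgroup.mem_carrier[OF normal_imp_subgroup[OF n(1)] x]] .
  qed
  have ED: "B #> conjg G g x = B #> x" if "g \<in> ?E" "chief_factor G A B" "A \<subseteq> P" "x \<in> A" for g A B x
    using that by (auto simp: chief_centralizer_def)
  have EG: "g \<in> carrier G" if "g \<in> ?E" for g using that by (simp add: chief_centralizer_def)
  have mem: "conjg G g x \<in> A" if "A \<lhd> G" "g \<in> carrier G" "x \<in> A" for A g x
    using that by (simp add: normal_conjg_iff)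
  have "subgroup ?E G"
  proof (rule subgroupI)
    show "?E \<subseteq> carrier G" using EG by blast
    have "\<one> \<in> ?E" by (rule EI) simp_all
    then show "?E \<noteq> {}" by blast
    fix a b assume a: "a \<in> ?E"
    show "inv a \<in> ?E"
    proof (rule EI)
      show "inv a \<in> carrier G" using EG[OF a] by simp
      fix A B x assume n: "A \<lhd> G" "B \<lhd> G" and c: "chief_factor G A B" "A \<subseteq> P" and x: "x \<in> A" "x \<in> carrier G"
      have "B #> conjg G a (conjg G (inv a) x) = B #> conjg G (inv a) x"
        using ED[OF a c mem[OF n(1) _ x(1)]] EG[OF a] by simp
      then show "B #> conjg G (inv a) x = B #> x" using EG[OF a] x(2) by simp
    qed
    assume b: "b \<in> ?E"
    show "a \<otimes> b \<in> ?E"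
    proof (rule EI)
      show "a \<otimes> b \<in> carrier G" using EG[OF a] EG[OF b] by simp
      fix A B x assume n: "A \<lhd> G" "B \<lhd> G" and c: "chief_factor G A B" "A \<subseteq> P" and x: "x \<in> A" "x \<in> carrier G"
      have "B #> conjg G b (conjg G a x) = B #> conjg G a x" using ED[OF b c mem[OF n(1) EG[OF a] x(1)]] .
      also have "\<dots> = B #> x" using ED[OF a c x(1)] .
      finally show "B #> conjg G (a \<otimes> b) x = B #> x" using conjg_conjg[OF EG[OF a] EG[OF b] x(2)] by simp
    qed
  qed
  moreover have "conjg G h g \<in> ?E" if h: "h \<in> carrier G" and g: "g \<in> ?E" for h g
  proof (rule EI)
    have gc: "g \<in> carrier G" using EG[OF g] .
    show "conjg G h g \<in> carrier G" using h gc by simp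
    fix A B x assume n: "A \<lhd> G" "B \<lhd> G" and c: "chief_factor G A B" "A \<subseteq> P" and x: "x \<in> A" "x \<in> carrier G"
    \<comment> \<open>With y = x^(h^-1), conjugating x by g^h amounts to conjugating y by g and then
      by h. As A is normal, y stays in A.\<close>
    let ?y = "conjg G (inv h) x"
    have yA: "?y \<in> A" using mem[OF n(1) _ x(1)] h by simp
    have yc: "?y \<in> carrier G" using h x(2) by simp
    have "conjg G (conjg G h g) x = conjg G (inv h \<otimes> g \<otimes> h) x" by (simp add: conjg_def[of G h g])
    also have "\<dots> = conjg G h (conjg G g ?y)" using h gc x(2) by (simp add: conjg_conjg m_assoc)
    finally have e: "conjg G (conjg G h g) x = conjg G h (conjg G g ?y)" .
    have "B #> conjg G h (conjg G g ?y) = B #> conjg G h ?y"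
      using r_coset_conjg_cong[OF n(2) h _ yc ED[OF g c yA]] gc yc by simp
    then show "B #> conjg G (conjg G h g) x = B #> x" using e h x(2) by simp
  qed
  ultimately show ?thesis by (simp add: normal_conjg_iff)
qed

text \<open>A cyclic chief factor below P has at most p elements and its identity B is fixed, so R
  moves fewer than p of them. The number moved is divisible by p, hence zero.\<close>

lemma p_subgroup_centralizes_chief:
  assumes "prime p" "subgroup P G" "card P = p ^ n"
    and cyc: "\<And>A B. \<lbrakk>chief_factor G A B; A \<subseteq> P\<rbrakk> \<Longrightarrow> cyclic_group (subgp G A Mod B)"
    and R: "subgroup R G" "card R = p ^ m"
  shows "R \<subseteq> chief_centralizer P"
proof
  fix r assume r: "r \<in> R"
  have Rc: "r \<in> carrier G" if "r \<in> R" for r using subgroup.mem_carrier[OF R(1) that] .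
  have "B #> conjg G r x = B #> x" if ch: "chief_factor G A B" "A \<subseteq> P" and x: "x \<in> A" for A B x
  proof -
    have n: "A \<lhd> G" "B \<lhd> G" using ch(1) by (simp_all add: chief_factor_def)
    have A: "subgroup A G" using normal_imp_subgroup[OF n(1)] .
    let ?E = "(\<lambda>x. B #> x) ` A"
    have fE: "finite ?E" using finite_subgroup[OF A] by simp
    interpret act: group_action "subgp G R" ?E "\<lambda>r. \<lambda>c \<in> ?E. conjg G (inv r) ` c"
      using conjg_coset_action[OF n R(1)] .
    let ?M = "{c \<in> ?E. \<exists>g\<in>carrier (subgp G R). (\<lambda>c \<in> ?E. conjg G (inv g) ` c) c \<noteq> c}"
    have dv: "p dvd card ?M"
      using act.fixed_points_mod_prime[OF assms(1) fE, of m] R(2) by (simp only: order_def) simp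
    have lt: "card ?M < p"
    proof -
      have "conjg G g ` B = B" if "g \<in> carrier G" for g using normal_conjg_image[OF n(2) that] .
      then have "B \<notin> ?M" using Rc by auto
      moreover have "B = B #> \<one>" using subgroup.subset[OF normal_imp_subgroup[OF n(2)]] by simp
      then have "B \<in> ?E" using subgroup.one_closed[OF A] by blast
      ultimately have "?M \<subset> ?E" by blast
      then have "card ?M < card ?E" by (rule psubset_card_mono[OF fE])
      also have "\<dots> \<le> p" using cyclic_chief_factor_card[OF assms(1) ch assms(2,3) cyc[OF ch]] .
      finally show ?thesis .
    qed
    have "\<not> 0 < card ?M" using nat_dvd_not_less[OF _ lt] dv by blast
    then have "card ?M = 0" by (simp only: not_gr_zero)
    moreover have "finite ?M" by (rule finite_subset[OF _ fE]) blast
    ultimately have M: "?M = {}" by simp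
    have ir: "inv r \<in> R" using subgroup.m_inv_closed[OF R(1) r] .
    have xc: "x \<in> carrier G" using subgroup.mem_carrier[OF A x] .
    have xE: "B #> x \<in> ?E" using x by blast
    have "inv r \<in> carrier (subgp G R)" using ir by simp
    then have "(\<lambda>c \<in> ?E. conjg G (inv (inv r)) ` c) (B #> x) = B #> x" using M xE by blast
    then have "conjg G r ` (B #> x) = B #> x" using xE Rc[OF r] by (simp only: restrict_apply' inv_inv if_True)
    then show ?thesis using conjg_r_coset[OF n(2) Rc[OF r] xc] by simp
  qed
  then show "r \<in> chief_centralizer P" using Rc[OF r] unfolding chief_centralizer_def by blast
qed

text \<open>Coprime action: if g fixes z = x^g x^-1, then conjugation by g^m multiplies x by z^m.\<close>

lemma p'_element_centralizes:
  assumes "prime p" "subgroup P G" "card P = p ^ n" "P \<lhd> G"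
    and g: "g \<in> chief_centralizer P" "g [^] m = \<one>" "coprime m p"
  shows "g \<in> Centralizer G P"
proof -
  have gc: "g \<in> carrier G" using g(1) by (simp add: chief_centralizer_def)
  have "A \<lhd> G \<Longrightarrow> A \<subseteq> P \<Longrightarrow> x \<in> A \<Longrightarrow> conjg G g x = x" for A x
  proof (induction "card A" arbitrary: A x rule: less_induct)
    case less
    have A: "subgroup A G" using normal_imp_subgroup[OF less.prems(1)] .
    have xc: "x \<in> carrier G" using subgroup.mem_carrier[OF A less.prems(3)] .
    show ?case
    proof (cases "A = {\<one>}")
      case True
      then show ?thesis using less.prems(3) gc by (simp add: conjg_def)
    next
      case False
      then obtain B where B: "chief_factor G A B" using chief_factor_below[OF less.prems(1)] by blast
      then have nB: "B \<lhd> G" and BA: "B \<subset> A" by (simp_all add: chief_factor_def)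
      have Bs: "subgroup B G" using normal_imp_subgroup[OF nB] .
      have lt: "card B < card A" using psubset_card_mono[OF finite_subgroup[OF A] BA] .
      \<comment> \<open>It lies in B because g acts trivially on A/B, so by the induction hypothesis
        for the smaller normal subgroup B it is fixed by g. Its order divides both a power of p and
        m, so it is 1.\<close>
      let ?z = "conjg G g x \<otimes> inv x"
      have zc: "?z \<in> carrier G" using gc xc by simp
      have "B #> conjg G g x = B #> x"
        using g(1) B less.prems(2,3) by (auto simp: chief_centralizer_def)
      then have zB: "?z \<in> B" using r_coset_eq_iff[OF Bs, of "conjg G g x" x] gc xc by simp
      have gz: "conjg G g ?z = ?z" using less.hyps[OF lt nB _ zB] BA less.prems(2) by blast
      have "conjg G (g [^] j) x = ?z [^] j \<otimes> x" for j :: nat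
      proof (induction j)
        case 0 then show ?case using xc by simp
      next
        case (Suc j)
        have "conjg G g (?z [^] j) = ?z [^] j"
          using group_hom.hom_nat_pow[OF conjg_hom[OF gc] zc, of j] gz by simp
        then have "conjg G g (?z [^] j \<otimes> x) = ?z [^] j \<otimes> conjg G g x" using conjg_mult[OF gc _ xc] zc by simp
        also have "\<dots> = ?z [^] j \<otimes> (?z \<otimes> x)" using gc xc by (simp add: m_assoc)
        also have "\<dots> = ?z [^] Suc j \<otimes> x" using zc xc by (simp add: m_assoc)
        finally have "conjg G g (conjg G (g [^] j) x) = ?z [^] Suc j \<otimes> x" using Suc by simp
        then show ?case using conjg_conjg[OF _ gc xc, of "g [^] j"] gc by simp
      qed
      from this[of m] have "x = ?z [^] m \<otimes> x" using g(2) xc by simp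
      then have zm: "?z [^] m = \<one>" using xc zc by (metis l_cancel_one' nat_pow_closed r_cancel_one')
      have "?z [^] (p ^ n) = \<one>" using pow_card_subgroup[OF assms(2), of ?z] zB BA less.prems(2) assms(3) by auto
      then have "ord ?z dvd p ^ n" "ord ?z dvd m" using zm pow_eq_id[OF zc] by auto
      then have "ord ?z = 1" using g(3) by (metis coprime_common_divisor_nat coprime_power_right_iff)
      then have "?z = \<one>" using ord_eq_1[OF zc] by simp
      then show ?thesis using gc xc by (metis conjg_closed inv_equality inv_inv inv_closed)
    qed
  qed
  then have "\<And>x. x \<in> P \<Longrightarrow> conjg G g x = x" using assms(4) by blast
  then show ?thesis using gc by (simp add: Centralizer_def)
qed

lemma sylow_of_overgroup:
  assumes "prime p" "sylow_subgroup p R G" "subgroup E G" "R \<subseteq> E"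
  shows "sylow_subgroup p R (subgp G E)"
proof -
  have R: "subgroup R G" "card R = p ^ multiplicity p (order G)" using assms(2) by (simp_all add: sylow_subgroup_def)
  have "multiplicity p (card E) \<le> multiplicity p (order G)"
    using card_subgroup_dvd[OF assms(3)] order_pos by (intro dvd_imp_multiplicity_le) auto
  moreover have "multiplicity p (order G) \<le> multiplicity p (card E)"
    using finite_group.card_p_subgroup_le[OF finite_group_subgp[OF assms(3)] assms(1) _ R(2)] R(1) assms(4)
    by (simp add: subgroup_subgp_iff[OF assms(3)] order_def)
  ultimately show ?thesis using R assms(4) by (simp add: sylow_subgroup_def subgroup_subgp_iff[OF assms(3)] order_def)
qed

text \<open>To be applied with the normalizer of P in the role of \<open>G\<close>. The equality of
  \<open>?E\<close> with the product \<open>?X\<close> of the centralizer and R is obtained from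
  orders, one prime at a time; the Frattini argument for \<open>?E\<close> then gives the
  factorization.\<close>

lemma normalizer_factorization:
  assumes "prime p" "P \<lhd> G" "card P = p ^ n"
    and cyc: "\<And>A B. \<lbrakk>chief_factor G A B; A \<subseteq> P\<rbrakk> \<Longrightarrow> cyclic_group (subgp G A Mod B)"
    and R: "sylow_subgroup p R G" and x: "x \<in> carrier G"
  shows "\<exists>c\<in>Centralizer G P. \<exists>y\<in>Normalizer G R. x = c \<otimes> y"
proof -
  let ?E = "chief_centralizer P" and ?C = "Centralizer G P"
  have P: "subgroup P G" using normal_imp_subgroup[OF assms(2)] .
  have Pc: "P \<subseteq> carrier G" using subgroup.subset[OF P] .
  have nE: "?E \<lhd> G" by (rule chief_centralizer_normal)
  have E: "subgroup ?E G" using normal_imp_subgroup[OF nE] .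
  have Rs: "subgroup R G" "card R = p ^ multiplicity p (order G)" using R by (simp_all add: sylow_subgroup_def)
  have RE: "R \<subseteq> ?E" using p_subgroup_centralizes_chief[OF assms(1) P assms(3) cyc Rs] .
  have C: "subgroup ?C G" using subgroup_Centralizer[OF Pc] .
  have "Normalizer G P = carrier G" using normal_conjg_image[OF assms(2)] by (auto simp: Normalizer_def)
  then have nC: "?C \<lhd> G" using Centralizer_normal[OF Pc] by simp
  have CE: "?C \<subseteq> ?E" unfolding Centralizer_def chief_centralizer_def by auto
  let ?X = "?C <#> R"
  have X: "subgroup ?X G" using mult_norm_subgroup[OF nC Rs(1)] .
  have XE: "?X \<subseteq> ?E" using CE RE subgroup.m_closed[OF E] by (auto simp: set_mult_def)
  have CX: "?C \<subseteq> ?X"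
  proof
    fix c assume c: "c \<in> ?C"
    then have "c \<otimes> \<one> \<in> ?X" using subgroup.one_closed[OF Rs(1)] unfolding set_mult_def by blast
    then show "c \<in> ?X" using subgroup.mem_carrier[OF C c] by simp
  qed
  have RX: "R \<subseteq> ?X"
  proof
    fix r assume r: "r \<in> R"
    then have "\<one> \<otimes> r \<in> ?X" using subgroup.one_closed[OF C] unfolding set_mult_def by blast
    then show "r \<in> ?X" using subgroup.mem_carrier[OF Rs(1) r] by simp
  qed
  \<comment> \<open>For q = p, R already accounts for the full p-part. For any other q, a Sylow
    q-subgroup of \<open>?E\<close> consists of elements of order prime to p and so lies in
    \<open>?C\<close>.\<close>
  have mult: "multiplicity q (card ?E) \<le> multiplicity q (card ?X)" if q: "prime q" for q :: nat
  proof -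
    interpret E: finite_group "subgp G ?E" using finite_group_subgp[OF E] .
    obtain Q where "sylow_subgroup q Q (subgp G ?E)" using E.sylow_exists[OF q] by blast
    then have Q: "subgroup Q G" "Q \<subseteq> ?E" "card Q = q ^ multiplicity q (card ?E)"
      by (simp_all add: sylow_subgroup_def subgroup_subgp_iff[OF E] order_def)
    have "q ^ multiplicity q (card ?E) dvd card ?X"
    proof (cases "q = p")
      case True
      have "multiplicity p (card ?E) \<le> multiplicity p (order G)"
        using card_subgroup_dvd[OF E] order_pos by (intro dvd_imp_multiplicity_le) auto
      then have "q ^ multiplicity q (card ?E) dvd card R" using True Rs(2) by (simp add: le_imp_power_dvd)
      then show ?thesis using card_subgroup_dvd_subgroup[OF Rs(1) X RX] dvd_trans by blast
    next
      case False
      have "Q \<subseteq> ?C"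
      proof
        fix g assume gQ: "g \<in> Q"
        have "coprime (card Q) p" using Q(3) primes_coprime[OF q assms(1) False] by simp
        then show "g \<in> ?C"
          using p'_element_centralizes[OF assms(1) P assms(3,2) _ pow_card_subgroup[OF Q(1) gQ]] Q(2) gQ by blast
      qed
      then have "Q \<subseteq> ?X" using CX by blast
      then show ?thesis using card_subgroup_dvd_subgroup[OF Q(1) X] Q(3) by simp
    qed
    then show ?thesis using card_subgroup_pos[OF X] q
      by (metis multiplicity_geI not_less_iff_gr_or_eq not_prime_unit)
  qed
  have "card ?E dvd card ?X"
    using card_subgroup_pos[OF E] mult by (intro multiplicity_le_imp_dvd) auto
  then have "card ?E \<le> card ?X" using card_subgroup_pos[OF X] dvd_imp_le by blast
  then have EX: "?E = ?X" using card_seteq[OF finite_subgroup[OF E] XE] by simp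
  have "sylow_subgroup p R (subgp G ?E)" using sylow_of_overgroup[OF assms(1) R E RE] .
  then obtain e y where ey: "e \<in> ?E" "y \<in> Normalizer G R" "x = e \<otimes> y"
    using frattini[OF assms(1) nE _ x] by blast
  then obtain c r where cr: "c \<in> ?C" "r \<in> R" "e = c \<otimes> r" using EX by (auto simp: set_mult_def)
  have N: "subgroup (Normalizer G R) G" using subgroup_Normalizer[OF subgroup.subset[OF Rs(1)]] .
  \<comment> \<open>The part r of e = c r that lies in R is absorbed into the factor normalizing
    R.\<close>
  have "r \<otimes> y \<in> Normalizer G R"
    using subgroup.m_closed[OF N _ ey(2)] subset_Normalizer[OF Rs(1)] cr(2) by blast
  moreover have "x = c \<otimes> (r \<otimes> y)"
    using ey(3) cr subgroup.mem_carrier[OF C cr(1)] subgroup.mem_carrier[OF Rs(1) cr(2)]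
      subgroup.mem_carrier[OF N ey(2)] by (simp add: m_assoc)
  ultimately show ?thesis using cr(1) by blast
qed

section \<open>Control of fusion\<close>

lemma Normalizer_subgp:
  assumes "subgroup N G"
  shows "Normalizer (subgp G N) X = N \<inter> Normalizer G X"
  using conjg_subgp[OF is_group assms] subgroup.mem_carrier[OF assms] by (auto simp: Normalizer_def)

lemma Centralizer_subgp:
  assumes "subgroup N G"
  shows "Centralizer (subgp G N) X = N \<inter> Centralizer G X"
  using conjg_subgp[OF is_group assms] subgroup.mem_carrier[OF assms] by (auto simp: Centralizer_def)

lemma conjg_Normalizer:
  assumes "h \<in> carrier G" "P \<subseteq> carrier G"
  shows "conjg G h ` Normalizer G P = Normalizer G (conjg G h ` P)"
proof -
  have sub: "conjg G k ` Normalizer G X \<subseteq> Normalizer G (conjg G k ` X)" if k: "k \<in> carrier G" and X: "X \<subseteq> carrier G" for k X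
  proof
    fix y assume "y \<in> conjg G k ` Normalizer G X"
    then obtain g where g: "g \<in> carrier G" "conjg G g ` X = X" "y = conjg G k g" by (auto simp: Normalizer_def)
    have "conjg G y ` conjg G k ` X = conjg G (k \<otimes> conjg G k g) ` X" using conjg_image_conjg[OF k _ X] g k by simp
    also have "k \<otimes> conjg G k g = g \<otimes> k" using g k by (simp add: conjg_def m_assoc mult_inv_cancel)
    also have "conjg G (g \<otimes> k) ` X = conjg G k ` X" using conjg_image_conjg[OF g(1) k X] g(2) by simp
    finally show "y \<in> Normalizer G (conjg G k ` X)" using g k by (simp add: Normalizer_def)
  qed
  let ?P = "conjg G h ` P"
  have Pc: "?P \<subseteq> carrier G" using conjg_image_closed[OF assms] .
  have "conjg G (inv h) ` Normalizer G ?P \<subseteq> Normalizer G P"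
    using sub[OF inv_closed[OF assms(1)] Pc] conjg_image_inv(1)[OF assms] by simp
  moreover have "Normalizer G ?P \<subseteq> carrier G" by (auto simp: Normalizer_def)
  ultimately have "Normalizer G ?P \<subseteq> conjg G h ` Normalizer G P"
    using conjg_image_inv(2)[OF assms(1)] image_mono by metis
  then show ?thesis using sub[OF assms] by blast
qed

text \<open>Says that conjugation by g agrees on P with conjugation by an element of the normalizer
  of S; the factor c acts first and does nothing on P.\<close>

definition controlled :: "'a set \<Rightarrow> 'a set \<Rightarrow> 'a \<Rightarrow> bool"
  where "controlled S P g \<longleftrightarrow> (\<exists>c\<in>Centralizer G P. \<exists>n\<in>Normalizer G S. g = c \<otimes> n)"

lemma controlled_mono: "\<lbrakk>controlled S Q g; P \<subseteq> Q\<rbrakk> \<Longrightarrow> controlled S P g"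
  unfolding controlled_def Centralizer_def by blast

lemma controlledE:
  assumes "controlled S P g"
  obtains c n where "c \<in> carrier G" "\<forall>x\<in>P. conjg G c x = x" "n \<in> carrier G" "n \<in> Normalizer G S" "g = c \<otimes> n"
  using assms unfolding controlled_def Centralizer_def Normalizer_def by blast

text \<open>If g = c n and h = d m, then g h = c (n d n^-1) (n m). Here d centralizes P^g = P^n, so
  n d n^-1 centralizes P.\<close>

lemma controlled_mult:
  assumes S: "S \<subseteq> carrier G" and P: "P \<subseteq> carrier G"
    and g: "controlled S P g" and h: "controlled S (conjg G g ` P) h"
  shows "controlled S P (g \<otimes> h)"
proof -
  obtain c n where c: "c \<in> carrier G" "\<forall>x\<in>P. conjg G c x = x" 
    and n: "n \<in> carrier G" "n \<in> Normalizer G S" and gcn: "g = c \<otimes> n" using controlledE[OF g] .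
  obtain d m where d: "d \<in> carrier G" "\<forall>x\<in>conjg G g ` P. conjg G d x = x"
    and m: "m \<in> carrier G" "m \<in> Normalizer G S" and hdm: "h = d \<otimes> m" using controlledE[OF h] .
  let ?e = "n \<otimes> d \<otimes> inv n"
  have "conjg G (c \<otimes> ?e) x = x" if x: "x \<in> P" for x
  proof -
    have xc: "x \<in> carrier G" using x P by blast
    have gx: "conjg G g x = conjg G n x" using gcn c(2)[rule_format, OF x] conjg_conjg[OF c(1) n(1) xc] by simp
    have "conjg G d (conjg G n x) = conjg G n x" using d(2) x gx by force
    then have "conjg G ?e x = x" using n(1) d(1) xc by (simp add: conjg_conjg[symmetric])
    then show ?thesis using c(2)[rule_format, OF x] conjg_conjg[OF c(1) _ xc, of ?e] n(1) d(1) by simp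
  qed
  then have "c \<otimes> ?e \<in> Centralizer G P" using c(1) n(1) d(1) by (simp add: Centralizer_def)
  moreover have "n \<otimes> m \<in> Normalizer G S" using subgroup.m_closed[OF subgroup_Normalizer[OF S] n(2) m(2)] .
  moreover have "g \<otimes> h = (c \<otimes> ?e) \<otimes> (n \<otimes> m)"
    using gcn hdm c(1) n(1) d(1) m(1) by (simp add: m_assoc mult_inv_cancel)
  ultimately show ?thesis unfolding controlled_def by blast
qed

text \<open>If g = c n, then g^-1 = (n^-1 c^-1 n) n^-1, and the bracket centralizes P^n =
  P^g.\<close>

lemma controlled_inv:
  assumes S: "S \<subseteq> carrier G" and P: "P \<subseteq> carrier G" and g: "controlled S P g"
  shows "controlled S (conjg G g ` P) (inv g)"
proof -
  obtain c n where c: "c \<in> carrier G" "\<forall>x\<in>P. conjg G c x = x" 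
    and n: "n \<in> carrier G" "n \<in> Normalizer G S" and gcn: "g = c \<otimes> n" using controlledE[OF g] .
  let ?e = "inv n \<otimes> inv c \<otimes> n"
  have "conjg G ?e y = y" if "y \<in> conjg G g ` P" for y
  proof -
    obtain x where x: "x \<in> P" "y = conjg G g x" using \<open>y \<in> conjg G g ` P\<close> by blast
    have xc: "x \<in> carrier G" using x P by blast
    have yx: "y = conjg G n x" using x(2) gcn c(2)[rule_format, OF x(1)] conjg_conjg[OF c(1) n(1) xc] by simp
    have "conjg G (inv c) x = conjg G (inv c) (conjg G c x)" using c(2)[rule_format, OF x(1)] by simp
    then have "conjg G (inv c) x = x" using c(1) xc by simp
    then show ?thesis unfolding yx using c(1) n(1) xc by (simp add: conjg_conjg[symmetric])
  qed
  then have "?e \<in> Centralizer G (conjg G g ` P)" using c(1) n(1) by (simp add: Centralizer_def)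
  moreover have "inv n \<in> Normalizer G S" using subgroup.m_inv_closed[OF subgroup_Normalizer[OF S] n(2)] .
  moreover have "inv g = ?e \<otimes> inv n"
    using gcn c(1) n(1) by (simp add: m_assoc inv_mult_group)
  ultimately show ?thesis unfolding controlled_def by blast
qed

lemma controlled_Centralizer_mult:
  assumes "P \<subseteq> carrier G" "Normalizer G S \<subseteq> carrier G" "c \<in> Centralizer G P" "controlled S P u"
  shows "controlled S P (c \<otimes> u)"
proof -
  obtain d n where dn: "d \<in> Centralizer G P" "n \<in> Normalizer G S" "u = d \<otimes> n"
    using assms(4) by (auto simp: controlled_def)
  have C: "subgroup (Centralizer G P) G" using subgroup_Centralizer[OF assms(1)] .
  have "c \<otimes> u = (c \<otimes> d) \<otimes> n"
    using dn assms(2) subgroup.mem_carrier[OF C assms(3)] subgroup.mem_carrier[OF C dn(1)] by (auto simp: m_assoc)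
  then show ?thesis using subgroup.m_closed[OF C assms(3) dn(1)] dn(2) unfolding controlled_def by blast
qed

text \<open>A Sylow subgroup R of the normalizer of P contains P. Conjugating R into S by h places
  it in S and in the normalizer of P^h, where it has full Sylow order.\<close>

lemma fully_normalized_conj:
  assumes "prime p" "sylow_subgroup p S G" "subgroup P G" "card P = p ^ n"
  shows "\<exists>h\<in>carrier G. conjg G h ` P \<subseteq> S \<and>
    sylow_subgroup p (S \<inter> Normalizer G (conjg G h ` P)) (subgp G (Normalizer G (conjg G h ` P)))"
proof -
  let ?N = "Normalizer G P"
  have Pc: "P \<subseteq> carrier G" using subgroup.subset[OF assms(3)] .
  have N: "subgroup ?N G" using subgroup_Normalizer[OF Pc] .
  have S: "subgroup S G" "card S = p ^ multiplicity p (order G)" using assms(2) by (simp_all add: sylow_subgroup_def)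
  interpret N: finite_group "subgp G ?N" using finite_group_subgp[OF N] .
  obtain R where RN: "sylow_subgroup p R (subgp G ?N)" using N.sylow_exists[OF assms(1)] by blast
  then have R: "subgroup R G" "R \<subseteq> ?N" "card R = p ^ multiplicity p (card ?N)"
    by (simp_all add: sylow_subgroup_def subgroup_subgp_iff[OF N] order_def)
  have Rc: "R \<subseteq> carrier G" using subgroup.subset[OF R(1)] .
  have PR: "P \<subseteq> R" using N.normal_p_subgroup_in_sylow[OF assms(1) RN normal_Normalizer[OF assms(3)] assms(4)] .
  obtain h where h: "h \<in> carrier G" "conjg G h ` R \<subseteq> S"
    using sylow_contains_conj[OF assms(1,2) R(1,3)] by blast
  let ?P = "conjg G h ` P"
  let ?M = "Normalizer G ?P"
  have M: "subgroup ?M G" using subgroup_Normalizer[OF conjg_image_closed[OF h(1) Pc]] .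
  have cM: "card ?M = card ?N"
    using conjg_Normalizer[OF h(1) Pc] card_conjg[OF h(1) subgroup.subset[OF N]] by simp
  have SM: "subgroup (S \<inter> ?M) G" using subgroups_Inter_pair[OF S(1) M] .
  have "conjg G h ` R \<subseteq> S \<inter> ?M" using h(2) R(2) conjg_Normalizer[OF h(1) Pc] by blast
  then have le: "p ^ multiplicity p (card ?N) \<le> card (S \<inter> ?M)"
    using card_mono[OF finite_subgroup[OF SM]] card_conjg[OF h(1) Rc] R(3) by metis
  have "card (S \<inter> ?M) dvd p ^ multiplicity p (order G)"
    using card_subgroup_dvd_subgroup[OF SM S(1)] S(2) by simp
  then obtain k where k: "card (S \<inter> ?M) = p ^ k" using assms(1) divides_primepow_nat by blast
  have "k \<le> multiplicity p (order (subgp G ?M))"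
    using finite_group.card_p_subgroup_le[OF finite_group_subgp[OF M] assms(1) _ k] SM
    by (simp add: subgroup_subgp_iff[OF M])
  then have "card (S \<inter> ?M) \<le> p ^ multiplicity p (card ?M)"
    using k prime_gt_0_nat[OF assms(1)] by (auto simp: order_def intro!: power_increasing)
  then have "card (S \<inter> ?M) = p ^ multiplicity p (card ?M)" using le cM by simp
  then have "sylow_subgroup p (S \<inter> ?M) (subgp G ?M)"
    using SM by (simp add: sylow_subgroup_def subgroup_subgp_iff[OF M] order_def)
  then show ?thesis using h PR by blast
qed

section \<open>Extending conjugations to larger subgroups of S\<close>

lemma normalizer_in_sylow_grows:
  assumes "prime p" "sylow_subgroup p S G" "subgroup P G" "P \<subset> S"
  shows "P \<subset> S \<inter> Normalizer G P"
proof -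
  have S: "subgroup S G" "card S = p ^ multiplicity p (order G)" using assms(2) by (simp_all add: sylow_subgroup_def)
  have "P \<subset> Normalizer (subgp G S) P"
    using finite_group.p_group_normalizer_grows[OF finite_group_subgp[OF S(1)] assms(1), of _ P] S assms(3,4)
    by (auto simp: order_def subgroup_subgp_iff[OF S(1)])
  then show ?thesis by (simp add: Normalizer_subgp[OF S(1)])
qed

text \<open>Up to a factor centralizing P, x is replaced by an element normalizing a larger subgroup
  Q of S, to which \<open>IH\<close> applies. If P contains its centralizer in S, then Q is the
  normalizer of P in S; otherwise Q is the product of P with its centralizer in S.\<close>

lemma fusion_control_step:
  assumes p: "prime p" and S: "sylow_subgroup p S G"
    and P: "subgroup P G" "P \<subset> S"
    and fn: "sylow_subgroup p (S \<inter> Normalizer G P) (subgp G (Normalizer G P))"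
    and centric: "\<And>x. \<lbrakk>S \<inter> Centralizer G P \<subseteq> P; x \<in> Normalizer G P\<rbrakk> \<Longrightarrow>
      \<exists>c\<in>Centralizer G P. \<exists>y\<in>Normalizer G (S \<inter> Normalizer G P). x = c \<otimes> y"
    and IH: "\<And>Q g. \<lbrakk>subgroup Q G; Q \<subseteq> S; card P < card Q; g \<in> carrier G; conjg G g ` Q \<subseteq> S\<rbrakk> \<Longrightarrow> controlled S Q g"
    and x: "x \<in> Normalizer G P"
  shows "controlled S P x"
proof -
  let ?N = "Normalizer G P" and ?C = "Centralizer G P"
  let ?R = "S \<inter> ?N" and ?Z = "S \<inter> ?C"
  have Pc: "P \<subseteq> carrier G" using subgroup.subset[OF P(1)] .
  have Ss: "subgroup S G" using S by (simp add: sylow_subgroup_def)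
  have N: "subgroup ?N G" using subgroup_Normalizer[OF Pc] .
  interpret N: finite_group "subgp G ?N" using finite_group_subgp[OF N] .
  have R: "subgroup ?R G" using subgroups_Inter_pair[OF Ss N] .
  have C: "subgroup ?C G" using subgroup_Centralizer[OF Pc] .
  have Z: "subgroup ?Z G" using subgroups_Inter_pair[OF Ss C] .
  have NS: "Normalizer G S \<subseteq> carrier G" by (auto simp: Normalizer_def)
  have "\<exists>c\<in>?C. \<exists>u\<in>carrier G. \<exists>Q. x = c \<otimes> u \<and> subgroup Q G \<and> Q \<subseteq> S \<and> P \<subset> Q \<and> conjg G u ` Q = Q"
  proof (cases "?Z \<subseteq> P")
    case True
    then obtain c y where cy: "c \<in> ?C" "y \<in> Normalizer G ?R" "x = c \<otimes> y" using centric x by blast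
    then have "y \<in> carrier G" "conjg G y ` ?R = ?R" by (simp_all add: Normalizer_def)
    then show ?thesis using cy R normalizer_in_sylow_grows[OF p S P] by blast
  next
    case False
    have nC: "?C \<lhd> subgp G ?N" using Centralizer_normal[OF Pc] .
    have CN: "?C \<subseteq> ?N" by (rule Centralizer_subset_Normalizer)
    have "?R \<inter> ?C = ?Z" using CN by blast
    \<comment> \<open>The Frattini argument needs \<open>?Z\<close> to be Sylow in the centralizer;
      this holds because \<open>?R\<close> is Sylow in the normalizer and \<open>?C\<close> is
      normal there.\<close>
    then have "sylow_subgroup p ?Z (subgp (subgp G ?N) ?C)" using N.sylow_Int_normal[OF p fn nC] by simp
    then obtain c y where cy: "c \<in> ?C" "y \<in> Normalizer (subgp G ?N) ?Z" "x = c \<otimes> y"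
      using N.frattini[OF p nC, of ?Z x] x by auto
    then have yN: "y \<in> ?N" "y \<in> Normalizer G ?Z" by (simp_all add: Normalizer_subgp[OF N])
    then have y: "y \<in> ?N" "conjg G y ` ?Z = ?Z" by (simp_all add: Normalizer_def[of G ?Z])
    have yc: "y \<in> carrier G" "conjg G y ` P = P" using y(1) by (auto simp: Normalizer_def)
    let ?Q = "P <#> ?Z"
    have "subgroup (P <#>\<^bsub>subgp G ?N\<^esub> ?Z) (subgp G ?N)"
      using N.mult_norm_subgroup[OF normal_Normalizer[OF P(1)]] Z CN by (auto simp: subgroup_subgp_iff[OF N])
    then have Q: "subgroup ?Q G" by (simp add: subgroup_subgp_iff[OF N])
    have QS: "?Q \<subseteq> S" using P(2) subgroup.m_closed[OF Ss] by (auto simp: set_mult_def)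
    have "a \<otimes> \<one> \<in> ?Q" if "a \<in> P" for a using that subgroup.one_closed[OF Z] unfolding set_mult_def by blast
    then have PQ: "P \<subseteq> ?Q" using Pc by force
    have "\<one> \<otimes> z \<in> ?Q" if "z \<in> ?Z" for z using that subgroup.one_closed[OF P(1)] unfolding set_mult_def by blast
    then have "?Z \<subseteq> ?Q" using subgroup.mem_carrier[OF Z] by force
    then have PQ': "P \<subset> ?Q" using PQ False by blast
    have "conjg G y q \<in> ?Q" if q: "q \<in> ?Q" for q
    proof -
      obtain a z where az: "a \<in> P" "z \<in> ?Z" "q = a \<otimes> z" using q by (auto simp: set_mult_def)
      have "conjg G y q = conjg G y a \<otimes> conjg G y z"
        using conjg_mult[OF yc(1)] az subgroup.mem_carrier[OF P(1)] subgroup.mem_carrier[OF Z] by simp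
      moreover have "conjg G y a \<in> P" "conjg G y z \<in> ?Z" using az(1,2) yc(2) y(2) by blast+
      ultimately show ?thesis unfolding set_mult_def by blast
    qed
    then have "conjg G y ` ?Q \<subseteq> ?Q" by blast
    then have "conjg G y ` ?Q = ?Q"
      by (rule conjg_image_eqI[OF finite_subgroup[OF Q] subgroup.subset[OF Q] yc(1)])
    then show ?thesis using cy(1,3) yc(1) Q QS PQ' by blast
  qed
  then obtain c u Q where cu: "c \<in> ?C" "u \<in> carrier G" "x = c \<otimes> u"
    and Q: "subgroup Q G" "Q \<subseteq> S" "P \<subset> Q" "conjg G u ` Q = Q" by blast
  have "controlled S Q u"
    using IH[OF Q(1,2) psubset_card_mono[OF finite_subgroup[OF Q(1)] Q(3)] cu(2)] Q(2,4) by simp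
  then have "controlled S P u" using controlled_mono Q(3) by blast
  then show ?thesis using controlled_Centralizer_mult[OF Pc NS cu(1)] cu(3) by simp
qed

text \<open>As in Alperin's fusion theorem, conjugation from P to a subgroup of S factors through a fully normalized
  conjugate Q of P, and each factor is induced by an element of the normalizer of Q or is the restriction
  of conjugation on a larger subgroup of S.\<close>

lemma fusion_control:
  assumes p: "prime p" and S: "sylow_subgroup p S G"
    and centric: "\<And>P x. \<lbrakk>subgroup P G; P \<subset> S;
        sylow_subgroup p (S \<inter> Normalizer G P) (subgp G (Normalizer G P));
        S \<inter> Centralizer G P \<subseteq> P; x \<in> Normalizer G P\<rbrakk> \<Longrightarrow>
      \<exists>c\<in>Centralizer G P. \<exists>y\<in>Normalizer G (S \<inter> Normalizer G P). x = c \<otimes> y"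
  shows "\<lbrakk>subgroup P G; P \<subseteq> S; g \<in> carrier G; conjg G g ` P \<subseteq> S\<rbrakk> \<Longrightarrow> controlled S P g"
proof (induction "card S - card P" arbitrary: P g rule: less_induct)
  case less
  note P = less.prems(1,2) and g = less.prems(3,4)
  have Ss: "subgroup S G" "card S = p ^ multiplicity p (order G)" using S by (simp_all add: sylow_subgroup_def)
  have Sc: "S \<subseteq> carrier G" using subgroup.subset[OF Ss(1)] .
  have Pc: "P \<subseteq> carrier G" using subgroup.subset[OF P(1)] .
  show ?case
  proof (cases "P = S")
    case True
    have "g \<in> Normalizer G S"
      using conjg_image_eqI[OF finite_subgroup[OF Ss(1)] Sc] g True by (simp add: Normalizer_def)
    moreover have "\<one> \<in> Centralizer G P" using subgroup.one_closed[OF subgroup_Centralizer[OF Pc]] .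
    moreover have "g = \<one> \<otimes> g" using g(1) by simp
    ultimately show ?thesis unfolding controlled_def by blast
  next
    case False
    then have PS: "P \<subset> S" using P(2) by blast
    have PltS: "card P < card S" using psubset_card_mono[OF finite_subgroup[OF Ss(1)] PS] .
    have IH: "controlled S Q k" if Q: "subgroup Q G" "Q \<subseteq> S" "card P < card Q" and k: "k \<in> carrier G" "conjg G k ` Q \<subseteq> S" for Q k
    proof (rule less.hyps[OF _ Q(1,2) k])
      show "card S - card Q < card S - card P" using Q(3) PltS by simp
    qed
    have "card P dvd p ^ multiplicity p (order G)"
      using card_subgroup_dvd_subgroup[OF P(1) Ss(1) P(2)] Ss(2) by simp
    then obtain n where n: "card P = p ^ n" using p divides_primepow_nat by blast
    obtain h where h: "h \<in> carrier G" and P1S: "conjg G h ` P \<subseteq> S"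
      and fn: "sylow_subgroup p (S \<inter> Normalizer G (conjg G h ` P)) (subgp G (Normalizer G (conjg G h ` P)))"
      using fully_normalized_conj[OF p S P(1) n] by blast
    let ?P = "conjg G h ` P"
    let ?N = "Normalizer G ?P"
    have P1: "subgroup ?P G" using subgroup_conjg[OF h P(1)] .
    have P1c: "?P \<subseteq> carrier G" using subgroup.subset[OF P1] .
    have cP1: "card ?P = card P" using card_conjg[OF h Pc] .
    then have P1S': "?P \<subset> S" using P1S PltS by auto
    have N: "subgroup ?N G" using subgroup_Normalizer[OF P1c] .
    have inN: "controlled S ?P x" if "x \<in> ?N" for x
      using fusion_control_step[OF p S P1 P1S' fn centric[OF P1 P1S' fn] _ that] IH cP1 by simp
    \<comment> \<open>Let T be the normalizer of Q in S, which is larger than Q. Its image under m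
      is a p-subgroup of \<open>?N\<close>, so some y in \<open>?N\<close> carries that image into
      S. Thus m y maps T into S and the induction hypothesis controls it.\<close>
    have toP1: "controlled S Q m"
      if Q: "subgroup Q G" "Q \<subseteq> S" "card Q = card P" and m: "m \<in> carrier G" "conjg G m ` Q = ?P" for Q m
    proof -
      have Qc: "Q \<subseteq> carrier G" using subgroup.subset[OF Q(1)] .
      have QS: "Q \<subset> S" using Q(2,3) PltS by auto
      let ?T = "S \<inter> Normalizer G Q"
      have T: "subgroup ?T G" using subgroups_Inter_pair[OF Ss(1) subgroup_Normalizer[OF Qc]] .
      have Tc: "?T \<subseteq> carrier G" using subgroup.subset[OF T] .
      have QT: "Q \<subset> ?T" using normalizer_in_sylow_grows[OF p S Q(1) QS] .
      have "card ?T dvd p ^ multiplicity p (order G)"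
        using card_subgroup_dvd_subgroup[OF T Ss(1)] Ss(2) by simp
      then obtain t where t: "card ?T = p ^ t" using p divides_primepow_nat by blast
      let ?U = "conjg G m ` ?T"
      have "?U \<subseteq> conjg G m ` Normalizer G Q" by (rule image_mono) blast
      then have "?U \<subseteq> ?N" using conjg_Normalizer[OF m(1) Qc] m(2) by simp
      then have "subgroup ?U (subgp G ?N)" using subgroup_conjg[OF m(1) T] by (simp add: subgroup_subgp_iff[OF N])
      moreover have "card ?U = p ^ t" using card_conjg[OF m(1) Tc] t by simp
      ultimately obtain y where y: "y \<in> ?N" "conjg (subgp G ?N) y ` ?U \<subseteq> S \<inter> ?N"
        using finite_group.sylow_contains_conj[OF finite_group_subgp[OF N] p fn, of ?U t] by auto
      have yc: "y \<in> carrier G" using subgroup.mem_carrier[OF N y(1)] .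
      have "conjg G (m \<otimes> y) ` ?T \<subseteq> S"
        using y(2) conjg_subgp[OF is_group N y(1)] conjg_image_conjg[OF m(1) yc Tc] by simp
      moreover have "card P < card ?T" using psubset_card_mono[OF finite_subgroup[OF T] QT] Q(3) by simp
      ultimately have "controlled S ?T (m \<otimes> y)" using IH[OF T] m(1) yc by blast
      then have 1: "controlled S Q (m \<otimes> y)" using controlled_mono QT by blast
      \<comment> \<open>The correction y normalizes \<open>?P\<close>, so its inverse is controlled
        by \<open>inN\<close> and can be composed away.\<close>
      have iy: "inv y \<in> ?N" using subgroup.m_inv_closed[OF N y(1)] .
      have "conjg G (m \<otimes> y) ` Q = ?P"
        using conjg_image_conjg[OF m(1) yc Qc] m(2) y(1) by (simp add: Normalizer_def)
      then have "controlled S Q ((m \<otimes> y) \<otimes> inv y)" using controlled_mult[OF Sc Qc 1] inN[OF iy] by simp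
      then show ?thesis using m(1) yc by (simp add: m_assoc)
    qed
    have hc: "controlled S P h" using toP1[OF P refl h refl] .
    let ?Pg = "conjg G g ` P"
    have Pgc: "?Pg \<subseteq> carrier G" using conjg_image_closed[OF g(1) Pc] .
    \<comment> \<open>Both P and P^g reach the fully normalized conjugate, by h and by g^-1 h. Going
      there and back recovers g = h (g^-1 h)^-1.\<close>
    have "g \<otimes> (inv g \<otimes> h) = h" using g(1) h mult_inv_cancel by simp
    then have to: "conjg G (inv g \<otimes> h) ` ?Pg = ?P" using conjg_image_conjg[OF g(1) _ Pc, of "inv g \<otimes> h"] g(1) h by simp
    have "controlled S ?Pg (inv g \<otimes> h)"
      using toP1[OF subgroup_conjg[OF g(1) P(1)] g(2) card_conjg[OF g(1) Pc] _ to] g(1) h by simp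
    then have "controlled S ?P (inv (inv g \<otimes> h))" using controlled_inv[OF Sc Pgc] to by metis
    then have "controlled S P (h \<otimes> inv (inv g \<otimes> h))" using controlled_mult[OF Sc Pc hc] by simp
    moreover have "h \<otimes> inv (inv g \<otimes> h) = g" using g(1) h by (simp add: inv_mult_group mult_inv_cancel)
    ultimately show ?thesis by simp
  qed
qed

section \<open>From control of fusion to a series of strongly closed subgroups\<close>

lemma cyclic_chief_series:
  assumes cyc: "\<And>A B. \<lbrakk>chief_factor G A B; A \<subseteq> S\<rbrakk> \<Longrightarrow> cyclic_group (subgp G A Mod B)"
  shows "\<lbrakk>A \<lhd> G; A \<subseteq> S\<rbrakk> \<Longrightarrow> \<exists>(n::nat) T. T 0 = {\<one>} \<and> T n = A \<and> (\<forall>i\<le>n. T i \<lhd> G \<and> T i \<subseteq> S) \<and>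
    (\<forall>i<n. T i \<subseteq> T (Suc i) \<and> cyclic_group (subgp G (T (Suc i)) Mod T i))"
proof (induction "card A" arbitrary: A rule: less_induct)
  case less
  show ?case
  proof (cases "A = {\<one>}")
    case True
    then show ?thesis using less.prems by (intro exI[of _ 0] exI[of _ "\<lambda>_. A"]) simp
  next
    case False
    obtain B where B: "chief_factor G A B" using chief_factor_below[OF less.prems(1) False] by blast
    then have nB: "B \<lhd> G" and BA: "B \<subset> A" by (simp_all add: chief_factor_def)
    have "card B < card A"
      using psubset_card_mono[OF finite_subgroup[OF normal_imp_subgroup[OF less.prems(1)]] BA] .
    moreover have "B \<subseteq> S" using BA less.prems(2) by blast
    ultimately obtain n :: nat and T where T: "T 0 = {\<one>}" "T n = B" "\<And>i. i \<le> n \<Longrightarrow> T i \<lhd> G \<and> T i \<subseteq> S"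
      "\<And>i. i < n \<Longrightarrow> T i \<subseteq> T (Suc i) \<and> cyclic_group (subgp G (T (Suc i)) Mod T i)"
      using less.hyps[OF _ nB] by blast
    let ?T = "T(Suc n := A)"
    have "?T 0 = {\<one>}" "?T (Suc n) = A" using T(1) by simp_all
    moreover have "?T i \<lhd> G \<and> ?T i \<subseteq> S" if "i \<le> Suc n" for i
      using that T(3)[of i] less.prems by (cases "i = Suc n") simp_all
    moreover have "?T i \<subseteq> ?T (Suc i) \<and> cyclic_group (subgp G (?T (Suc i)) Mod ?T i)" if "i < Suc n" for i
    proof (cases "i = n")
      case True
      then show ?thesis using T(2) BA cyc[OF B less.prems(2)] by auto
    next
      case False
      then show ?thesis using T(4)[of i] that by simp
    qed
    ultimately show ?thesis by blast
  qed
qed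

text \<open>By control, every fusion map on P is the restriction of conjugation by an element of the
  normalizer of S, and such elements preserve T.\<close>

lemma strongly_closed_of_control:
  assumes S: "subgroup S G"
    and ctrl: "\<And>P g. \<lbrakk>subgroup P G; P \<subseteq> S; g \<in> carrier G; conjg G g ` P \<subseteq> S\<rbrakk> \<Longrightarrow> controlled S P g"
    and T: "T \<lhd> subgp G (Normalizer G S)" "T \<subseteq> S"
  shows "strongly_closed (subgp G S) (group_fusion G S) T"
  unfolding strongly_closed_def
proof (intro conjI allI impI; (elim conjE)?)
  have N: "subgroup (Normalizer G S) G" using subgroup_Normalizer[OF subgroup.subset[OF S]] .
  have Ts: "subgroup T G" using normal_imp_subgroup[OF T(1)] by (simp add: subgroup_subgp_iff[OF N])
  then show "subgroup T (subgp G S)" using T(2) by (simp add: subgroup_subgp_iff[OF S])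
  fix P \<phi> assume P: "subgroup P (subgp G S)" and PT: "P \<subseteq> T" and "\<phi> \<in> group_fusion G S P (carrier (subgp G S))"
  then obtain g where g: "g \<in> carrier G" "conjg G g ` P \<subseteq> S" "\<phi> = restrict (conjg G g) P"
    unfolding group_fusion_def conjg_def by auto
  have Ps: "subgroup P G" "P \<subseteq> S" using P by (simp_all add: subgroup_subgp_iff[OF S])
  obtain c n where c: "c \<in> carrier G" "\<forall>x\<in>P. conjg G c x = x"
    and n: "n \<in> carrier G" "n \<in> Normalizer G S" and gcn: "g = c \<otimes> n"
    using controlledE[OF ctrl[OF Ps g(1,2)]] .
  have "conjg G g x \<in> T" if x: "x \<in> P" for x
  proof -
    have "conjg G g x = conjg G n x"
      using conjg_conjg[OF c(1) n(1) subgroup.mem_carrier[OF Ps(1) x]] c(2)[rule_format, OF x] gcn by simp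
    moreover have "conjg (subgp G (Normalizer G S)) n x \<in> T"
      using T(1) n(2) x PT by (auto simp: group.normal_conjg_iff[OF subgroup_imp_group[OF N]])
    ultimately show ?thesis using conjg_subgp[OF is_group N n(2)] by simp
  qed
  then show "\<phi> ` P \<subseteq> T" using g(3) by auto
qed

end

section \<open>Conditions (0) and (4) in normalizers of subgroups of S\<close>

theorem theorem3p8:
  fixes G :: "'a monoid" and R :: "'a set \<Rightarrow> 'a monoid \<Rightarrow> bool"
    and p :: nat and S D :: "'a set"
  assumes "four_eternal R"
    and "group G" and "finite (carrier G)"
    and "prime p" and "p dvd order G"
    and "sylow_subgroup p S G"
    and "subgroup D G" and "D \<subseteq> S" and "1 < card D" and "card D < card S"
    and "\<And>H. subgroup H G \<Longrightarrow> H \<subseteq> S \<Longrightarrow> card H = card D \<or> card H = p * card D \<Longrightarrow>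
           comm_group (subgp G H)"
    and "\<And>H. subgroup H G \<Longrightarrow> H \<subseteq> S \<Longrightarrow> card H = card D \<Longrightarrow> R H G"
    and "\<And>H. p = 2 \<Longrightarrow> subgroup H G \<Longrightarrow> H \<subseteq> S \<Longrightarrow> cyclic_group (subgp G H) \<Longrightarrow> card H = 4 \<Longrightarrow> R H G"
  shows "supersolvable_fusion (subgp G S) (group_fusion G S)"
proof -
  interpret finite_group G by (simp add: finite_group_def finite_group_axioms_def assms(2,3))
  note p = assms(4)
  have S: "subgroup S G" "card S = p ^ multiplicity p (order G)" using assms(6) by (simp_all add: sylow_subgroup_def)
  have Sc: "S \<subseteq> carrier G" using subgroup.subset[OF S(1)] .
  interpret S: finite_group "subgp G S" using finite_group_subgp[OF S(1)] .
  have "card D dvd p ^ multiplicity p (order G)"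
    using card_subgroup_dvd_subgroup[OF assms(7) S(1) assms(8)] S(2) by simp
  then obtain d where d: "card D = p ^ d" using p divides_primepow_nat by blast
  \<comment> \<open>Allows P = S, so that it serves both the centric subgroups in the fusion
    argument and the final series through S.\<close>
  have cyc: "cyclic_group (subgp (subgp G (Normalizer G P)) A Mod B)"
    if P: "subgroup P G" "P \<subseteq> S" "card D < card P"
      and fn: "sylow_subgroup p (S \<inter> Normalizer G P) (subgp G (Normalizer G P))"
      and ch: "chief_factor (subgp G (Normalizer G P)) A B" "A \<subseteq> P" for P A B
  proof -
    let ?N = "Normalizer G P"
    let ?K = "subgp G ?N"
    have N: "subgroup ?N G" using subgroup_Normalizer[OF subgroup.subset[OF P(1)]] .
    interpret K: finite_group ?K using finite_group_subgp[OF N] .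
    let ?O = "p_core p ?K"
    have nO: "?O \<lhd> ?K" using K.p_core_normal[OF p] .
    have O: "subgroup ?O ?K" using normal_imp_subgroup[OF nO] .
    obtain j where j: "card ?O = p ^ j" using K.card_p_core[OF p] by blast
    have OS: "?O \<subseteq> S" using K.normal_p_subgroup_in_sylow[OF p fn nO j] by blast
    have "card P dvd p ^ multiplicity p (order G)"
      using card_subgroup_dvd_subgroup[OF P(1) S(1) P(2)] S(2) by simp
    then obtain n where "card P = p ^ n" using p divides_primepow_nat by blast
    then have PO: "P \<subseteq> ?O" using K.subset_p_core[OF p normal_Normalizer[OF P(1)]] by blast
    then have DO: "card D < card ?O" using card_mono[OF K.finite_subgroup[OF O] PO] P(3) by simp
    have dj: "d < j" using DO d j prime_gt_1_nat[OF p] by simp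
    have "p dvd card ?O" using dj j by (simp add: dvd_power)
    then have pK: "p dvd order ?K" using K.card_subgroup_dvd[OF O] dvd_trans by blast
    \<comment> \<open>Condition (0): the relation descends from the whole group to the
      normalizer.\<close>
    have relK: "R H ?K" if "subgroup H ?K" "R H G" for H
      using assms(1-3) N that unfolding four_eternal_def subgroup_subgp_iff[OF N] by blast
    interpret O: finite_group "subgp ?K ?O" using K.finite_group_subgp[OF O] .
    \<comment> \<open>A substitute for D inside the p-core: d < j leaves room for a subgroup of
      order p^d, grown from the trivial one. The hypotheses depend on D only through its
      order.\<close>
    have "\<exists>T. subgroup T (subgp ?K ?O) \<and> {\<one>\<^bsub>G\<^esub>} \<subseteq> T \<and> card T = p ^ d"
      using O.p_group_overgroup[OF p _ O.triv_subgroup, of j d] j dj prime_gt_0_nat[OF p] by (simp add: order_def)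
    then obtain E where E: "subgroup E ?K" "E \<subseteq> ?O" "card E = card D"
      using d K.subgroup_subgp_iff[OF O] by auto
    have sub: "subgroup H G" if "subgroup H ?K" for H using that by (simp add: subgroup_subgp_iff[OF N])
    have 1: "\<forall>H. subgroup H ?K \<and> H \<subseteq> ?O \<and> card H = card E \<longrightarrow> R H ?K"
      using assms(12) relK sub E(3) OS by (metis subset_trans)
    have 2: "p = 2 \<longrightarrow> (\<forall>H. subgroup H ?K \<and> H \<subseteq> ?O \<and> cyclic_group (subgp ?K H) \<and> card H = 4 \<longrightarrow> R H ?K)"
    proof (intro impI allI; elim conjE)
      fix H assume "p = 2" and H: "subgroup H ?K" "H \<subseteq> ?O" "cyclic_group (subgp ?K H)" "card H = 4"
      then have "R H G" using assms(13)[of H] sub[OF H(1)] OS by simp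
      then show "R H ?K" using relK H(1) by blast
    qed
    have "?O \<subseteq> supersolvable_hypercenter ?K"
      using assms(1) K.is_group K.fin p pK E(1,2) assms(9) DO E(3) 1 2 unfolding four_eternal_def by metis
    then have "A \<subseteq> supersolvable_hypercenter ?K" using ch(2) PO by blast
    then show ?thesis using K.hypercentral_hypercenter ch(1) unfolding K.hypercentral_def by blast
  qed
  have centric: "\<exists>c\<in>Centralizer G P. \<exists>y\<in>Normalizer G (S \<inter> Normalizer G P). x = c \<otimes>\<^bsub>G\<^esub> y"
    if P: "subgroup P G" "P \<subset> S" and fn: "sylow_subgroup p (S \<inter> Normalizer G P) (subgp G (Normalizer G P))"
      and cen: "S \<inter> Centralizer G P \<subseteq> P" and x: "x \<in> Normalizer G P" for P x
  proof -
    have PS: "P \<subseteq> S" using P(2) by blast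
    have N: "subgroup (Normalizer G P) G" using subgroup_Normalizer[OF subgroup.subset[OF P(1)]] .
    interpret N: finite_group "subgp G (Normalizer G P)" using finite_group_subgp[OF N] .
    have "card D < card P"
    proof (rule ccontr)
      assume "\<not> card D < card P"
      then have le: "card P \<le> p ^ d" using d by simp
      \<comment> \<open>Because |D| < |S|, there is room in S for order p^(d+1) = p|D|, the order at
        which subgroups are still abelian.\<close>
      have "d < multiplicity p (order G)" using assms(10) d S(2) prime_gt_1_nat[OF p] by simp
      moreover have "card P \<le> p ^ Suc d"
        using le power_increasing[of d "Suc d" p] prime_gt_0_nat[OF p] by linarith
      ultimately obtain T where "subgroup T (subgp G S)" and PT: "P \<subseteq> T" and cT: "card T = p ^ Suc d"
        using S.p_group_overgroup[OF p, of "multiplicity p (order G)" P "Suc d"] S P(1) PS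
        by (auto simp: order_def subgroup_subgp_iff[OF S(1)])
      then have T: "subgroup T G" "T \<subseteq> S" by (simp_all add: subgroup_subgp_iff[OF S(1)])
      interpret T: comm_group "subgp G T" using assms(11)[OF T] cT d by simp
      have "T \<subseteq> Centralizer G P"
      proof
        fix t assume t: "t \<in> T"
        have tc: "t \<in> carrier G" using subgroup.mem_carrier[OF T(1) t] .
        have "conjg G t x = x" if x: "x \<in> P" for x
        proof -
          have xc: "x \<in> carrier G" using subgroup.mem_carrier[OF P(1) x] .
          have "x \<otimes>\<^bsub>G\<^esub> t = t \<otimes>\<^bsub>G\<^esub> x" using T.m_comm[of x t] t x PT by auto
          then show ?thesis using tc xc by (simp add: conjg_def m_assoc mult_inv_cancel)
        qed
        then show "t \<in> Centralizer G P" using tc by (simp add: Centralizer_def)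
      qed
      \<comment> \<open>T is abelian and contains P, so it centralizes P and must lie in P; but |T|
        = p|D| exceeds |P|.\<close>
      then have "T \<subseteq> P" using cen T(2) by blast
      then have "card T \<le> card P" by (rule card_mono[OF finite_subgroup[OF P(1)]])
      then have "p ^ Suc d \<le> p ^ d" using cT le by linarith
      then show False using prime_gt_1_nat[OF p] by simp
    qed
    note cycP = cyc[OF P(1) PS this fn]
    have "card P dvd p ^ multiplicity p (order G)"
      using card_subgroup_dvd_subgroup[OF P(1) S(1) PS] S(2) by simp
    then obtain n where n: "card P = p ^ n" using p divides_primepow_nat by blast
    show ?thesis
      using N.normalizer_factorization[OF p normal_Normalizer[OF P(1)] n cycP fn, of x] x
      by (auto simp: Centralizer_subgp[OF N] Normalizer_subgp[OF N])
  qed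
  note ctrl = fusion_control[OF p assms(6) centric]
  let ?K = "subgp G (Normalizer G S)"
  have N: "subgroup (Normalizer G S) G" using subgroup_Normalizer[OF Sc] .
  interpret K: finite_group ?K using finite_group_subgp[OF N] .
  have SN: "S \<subseteq> Normalizer G S" using subset_Normalizer[OF S(1)] .
  \<comment> \<open>S is itself fully normalized, so \<open>cyc\<close> makes every chief factor of
    its normalizer below S cyclic.\<close>
  then have "sylow_subgroup p (S \<inter> Normalizer G S) ?K"
    using sylow_of_overgroup[OF p assms(6) N] by (simp add: inf_absorb1)
  note cycS = cyc[OF S(1) subset_refl assms(10) this]
  obtain n :: nat and T where T: "T 0 = {\<one>\<^bsub>G\<^esub>}" "T n = S" "\<And>i. i \<le> n \<Longrightarrow> T i \<lhd> ?K \<and> T i \<subseteq> S"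
    "\<And>i. i < n \<Longrightarrow> T i \<subseteq> T (Suc i) \<and> cyclic_group (subgp ?K (T (Suc i)) Mod T i)"
    using K.cyclic_chief_series[OF cycS normal_Normalizer[OF S(1)] subset_refl] by auto
  have "strongly_closed (subgp G S) (group_fusion G S) (T i)" if "i \<le> n" for i
  proof (rule strongly_closed_of_control[OF S(1)])
    show "controlled S P g" if "subgroup P G" "P \<subseteq> S" "g \<in> carrier G" "conjg G g ` P \<subseteq> S" for P g
      using ctrl[OF _ _ _ _ _ that] .
  qed (use T(3)[OF that] in auto)
  \<comment> \<open>Nested \<open>subgp\<close> keeps only the last carrier, so the quotients formed
    in \<open>?K\<close> are literally those required in \<open>subgp G S\<close>.\<close>
  then show ?thesis
    unfolding supersolvable_fusion_def using T by (intro exI[of _ n] exI[of _ T]) simp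
qed

end
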